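(* Let $D$ be a weighted naturally oriented unicyclic graph whose unique cycle is an odd cycle $C_{2n+1}=(x_1,\ldots,x_{2n+1})$. Then $I(D)^{(s)}=I(D)^s$ for all $s\ge2$ if and only if $w(x)\ge2$ for every $x\in V(D)$ with $\deg_D(x)\ge2$.
   Context: Let $k$ be a field. A weighted oriented graph $D=(V(D),E(D),w)$ has a finite vertex set $V(D)$, a set $E(D)$ of ordered pairs of distinct vertices ($(x,y)\in E(D)$ is a directed edge from $x$ to $y$), each edge $\{x,y\}$ of the underlying simple graph $G$ carrying exactly one orientation, and a weight function $w:V(D)\to\mathbb N=\{1,2,\dots\}$. A vertex is a source if it has only outgoing edges; convention: sources have weight $1$. The edge ideal of $D$ is $I(D)=(x\,y^{w(y)} : (x,y)\in E(D))$ in the polynomial ring $R$ over $k$ whose variables are the vertices of $D$. For $s\ge1$ the $s$-th symbolic power of an ideal $I$ is $I^{(s)}=\bigcap_{P\in\operatorname{Ass}(I)}(I^sR_P\cap R)$, where $\operatorname{Ass}(I)$ is the set of associated primes of $R/I$. $\deg_D(x)$ is the number of neighbours of $x$ in the underlying graph. A cycle is naturally oriented if all its edges are oriented in the clockwise direction (i.e. it is a directed cycle). A naturally oriented unicyclic graph is an oriented graph whose underlying graph is connected with exactly one cycle, such that the cycle is naturally oriented and each edge of the trees attached to the cycle is oriented away from the cycle. *)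

theory Defs
  imports
    "HOL-Library.Poly_Mapping"
    "HOL-Algebra.Ideal_Product"
    "HOL-Algebra.QuotRing"
    "Graph_Theory.Digraph_Component"
begin

section \<open>Commutative algebra\<close>

text \<open>The annihilator in \<open>R\<close> of an element of the \<open>R\<close>-module \<open>R / I\<close>, on which \<open>r\<close> acts as
  multiplication by its residue class \<open>I + r\<close>.\<close>

definition quot_annihilator :: "('a, 'b) ring_scheme \<Rightarrow> 'a set \<Rightarrow> 'a set \<Rightarrow> 'a set" where
  "quot_annihilator R I m =
     {r \<in> carrier R. (I +>\<^bsub>R\<^esub> r) \<otimes>\<^bsub>R Quot I\<^esub> m = \<zero>\<^bsub>R Quot I\<^esub>}"

definition assoc_primes :: "('a, 'b) ring_scheme \<Rightarrow> 'a set \<Rightarrow> 'a set set" where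
  "assoc_primes R I =
     {P. primeideal P R \<and> (\<exists>m \<in> carrier (R Quot I). P = quot_annihilator R I m)}"

text \<open>The localization \<open>R\<^sub>P\<close> of a commutative ring at a prime ideal, as equivalence classes of
  pairs (numerator, denominator).\<close>

definition loc_rel :: "('a, 'b) ring_scheme \<Rightarrow> 'a set \<Rightarrow> (('a \<times> 'a) \<times> ('a \<times> 'a)) set" where
  "loc_rel R P =
     {((a, u), (b, v)) | a u b v.
        a \<in> carrier R \<and> b \<in> carrier R \<and> u \<in> carrier R - P \<and> v \<in> carrier R - P \<and>
        (\<exists>t \<in> carrier R - P. t \<otimes>\<^bsub>R\<^esub> (a \<otimes>\<^bsub>R\<^esub> v) = t \<otimes>\<^bsub>R\<^esub> (b \<otimes>\<^bsub>R\<^esub> u))}"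

definition loc_frac :: "('a, 'b) ring_scheme \<Rightarrow> 'a set \<Rightarrow> 'a \<Rightarrow> 'a \<Rightarrow> ('a \<times> 'a) set" where
  "loc_frac R P a u = loc_rel R P `` {(a, u)}"

definition localization :: "('a, 'b) ring_scheme \<Rightarrow> 'a set \<Rightarrow> (('a \<times> 'a) set) ring" where
  "localization R P =
     \<lparr>carrier = (carrier R \<times> (carrier R - P)) // loc_rel R P,
      monoid.mult = (\<lambda>X Y. \<Union>(a, u) \<in> X. \<Union>(b, v) \<in> Y. loc_frac R P (a \<otimes>\<^bsub>R\<^esub> b) (u \<otimes>\<^bsub>R\<^esub> v)),
      one = loc_frac R P \<one>\<^bsub>R\<^esub> \<one>\<^bsub>R\<^esub>,
      zero = loc_frac R P \<zero>\<^bsub>R\<^esub> \<one>\<^bsub>R\<^esub>,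
      add = (\<lambda>X Y. \<Union>(a, u) \<in> X. \<Union>(b, v) \<in> Y.
               loc_frac R P (a \<otimes>\<^bsub>R\<^esub> v \<oplus>\<^bsub>R\<^esub> b \<otimes>\<^bsub>R\<^esub> u) (u \<otimes>\<^bsub>R\<^esub> v))\<rparr>"

definition to_localization :: "('a, 'b) ring_scheme \<Rightarrow> 'a set \<Rightarrow> 'a \<Rightarrow> ('a \<times> 'a) set" where
  "to_localization R P f = loc_frac R P f \<one>\<^bsub>R\<^esub>"

definition extend_contract :: "('a, 'b) ring_scheme \<Rightarrow> 'a set \<Rightarrow> 'a set \<Rightarrow> 'a set" where
  "extend_contract R P J =
     {f \<in> carrier R. to_localization R P f \<in> Idl\<^bsub>localization R P\<^esub> (to_localization R P ` J)}"

text \<open>The intersection is taken inside \<open>R\<close>, so an empty set of associated primes gives \<open>R\<close>.\<close>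

definition symbolic_power :: "('a, 'b) ring_scheme \<Rightarrow> 'a set \<Rightarrow> nat \<Rightarrow> 'a set" where
  "symbolic_power R I s =
     carrier R \<inter> (\<Inter>P \<in> assoc_primes R I. extend_contract R P (I [^]\<^bsub>ideals_set R\<^esub> s))"

section \<open>Polynomial rings\<close>

text \<open>A polynomial maps exponent vectors, themselves finitely supported, to coefficients.\<close>

type_synonym ('v, 'k) mpoly = "('v \<Rightarrow>\<^sub>0 nat) \<Rightarrow>\<^sub>0 'k"

definition poly_ring :: "'v set \<Rightarrow> ('v, 'k::field) mpoly ring" where
  "poly_ring V =
     \<lparr>carrier = {p. \<forall>m \<in> Poly_Mapping.keys p. Poly_Mapping.keys m \<subseteq> V},
      monoid.mult = (*), one = 1, zero = 0, add = (+)\<rparr>"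

definition var :: "'v \<Rightarrow> ('v, 'k::field) mpoly" where
  "var x = Poly_Mapping.single (Poly_Mapping.single x 1) 1"

section \<open>Weighted oriented graphs\<close>

locale weighted_oriented_graph = pair_digraph D
  for D :: "'v pair_pre_digraph" +
  fixes w :: "'v \<Rightarrow> nat"
  assumes one_orientation: "(x, y) \<in> parcs D \<Longrightarrow> (y, x) \<notin> parcs D"
    and weight_pos: "x \<in> pverts D \<Longrightarrow> w x \<ge> 1"
    and weight_source: "x \<in> pverts D \<Longrightarrow> in_arcs D x = {} \<Longrightarrow> w x = 1"

definition edge_ideal :: "'v pair_pre_digraph \<Rightarrow> ('v \<Rightarrow> nat) \<Rightarrow> ('v, 'k::field) mpoly set" where
  "edge_ideal D w =
     Idl\<^bsub>poly_ring (pverts D)\<^esub> {var x * var y ^ w y | x y. (x, y) \<in> parcs D}"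

definition graph_degree :: "'v pair_pre_digraph \<Rightarrow> 'v \<Rightarrow> nat" where
  "graph_degree D x = card {y. (x, y) \<in> parcs (mk_symmetric D)}"

text \<open>In the symmetric digraph representing a simple graph, an edge traversed back and forth is a
  \<open>cycle\<close> of length 2; these are excluded.\<close>

definition underlying_cycle :: "'v pair_pre_digraph \<Rightarrow> ('v \<times> 'v) list \<Rightarrow> bool" where
  "underlying_cycle D p \<longleftrightarrow> pre_digraph.cycle (mk_symmetric D) p \<and> length p \<ge> 3"

text \<open>A cycle as a subgraph is its set of undirected edges, which does not depend on the starting
  vertex or the direction of traversal.\<close>

definition unicyclic :: "'v pair_pre_digraph \<Rightarrow> bool" where
  "unicyclic D \<longleftrightarrow> Digraph_Component.connected D \<and>
     (\<exists>!C. \<exists>p. underlying_cycle D p \<and> C = (\<lambda>(x, y). {x, y}) ` set p)"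

definition graph_dist :: "'v pair_pre_digraph \<Rightarrow> 'v set \<Rightarrow> 'v \<Rightarrow> nat" where
  "graph_dist D S x =
     (LEAST d. \<exists>c \<in> S. \<exists>q. pre_digraph.awalk (mk_symmetric D) c q x \<and> length q = d)"

text \<open>An edge off the cycle is oriented away from it if its head is farther from the cycle than its
  tail.\<close>

definition naturally_oriented_unicyclic :: "'v pair_pre_digraph \<Rightarrow> bool" where
  "naturally_oriented_unicyclic D \<longleftrightarrow> unicyclic D \<and>
     (\<exists>p. underlying_cycle D p \<and> set p \<subseteq> parcs D \<and>
        (\<forall>(x, y) \<in> parcs D - set p. graph_dist D (fst ` set p) x < graph_dist D (fst ` set p) y))"

end

theory Submission
  imports Defs
begin

text \<open>Every vertex \<open>x\<close> has exactly one in-neighbour. If all vertices of degree at least 2 have weight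
  at least 2, then the monomial with exponents \<open>w x - 1\<close> has the irrelevant maximal ideal as its
  annihilator modulo \<open>I(D)\<close>. So this ideal is associated, and localizing at it does not
  enlarge a monomial ideal.

  Conversely, if \<open>w p = 1\<close> for an edge \<open>(p, v)\<close>, then every associated prime avoids \<open>p\<close>, \<open>v\<close> or an
  out-neighbour of \<open>v\<close>. To put a monomial \<open>f\<close> into \<open>I(D)\<^sup>(\<^sup>s\<^sup>)\<close> it therefore suffices that multiplying
  \<open>f\<close> by a power of any of these variables leads into \<open>I(D)\<^sup>s\<close>. If \<open>p\<close> is on the cycle, take
  for \<open>f\<close> the product of all \<open>x\<^sup>w\<^sup>(\<^sup>x\<^sup>)\<close> over the cycle and \<open>s = n + 1\<close>. Otherwise there is a path
  \<open>u \<rightarrow> y \<rightarrow> x \<rightarrow> z\<close> with \<open>x\<close> off the cycle, \<open>w x = 1\<close> and \<open>w y \<ge> 2\<close>; take \<open>f = u y\<^sup>w\<^sup>(\<^sup>y\<^sup>) x z\<close> and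
  \<open>s = 2\<close> if \<open>w z \<ge> 2\<close>, and \<open>f = u y\<^sup>w\<^sup>(\<^sup>y\<^sup>) x\<^sup>2 z\<close> and \<open>s = 3\<close> if \<open>w z = 1\<close>.\<close>

section \<open>Localization at a prime ideal\<close>

text \<open>The operations of \<open>localization\<close> are unions over all representatives of two
  classes; such a union is a single class as soon as every pair of representatives yields that
  class.\<close>

lemma UN_UN_const:
  assumes "p \<in> X" "q \<in> Y" "\<And>a u b v. (a, u) \<in> X \<Longrightarrow> (b, v) \<in> Y \<Longrightarrow> F a u b v = K"
  shows "(\<Union>(a, u)\<in>X. \<Union>(b, v)\<in>Y. F a u b v) = K"
proof -
  have "(\<Union>(b, v)\<in>Y. F a u b v) = K" if "(a, u) \<in> X" for a u
    using that assms(2,3) by (intro UN_constant_eq[of q]) auto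
  then show ?thesis
    using assms(1) by (intro UN_constant_eq[of p]) (simp_all add: split_beta)
qed

lemma (in primeideal) one_in_complement: "\<one> \<in> carrier R - I"
  using I_notcarr one_imp_carrier by auto

lemma (in primeideal) mult_in_complement:
  "u \<in> carrier R - I \<Longrightarrow> v \<in> carrier R - I \<Longrightarrow> u \<otimes> v \<in> carrier R - I"
  using I_prime by auto

lemma (in primeideal) loc_relI:
  assumes "a \<in> carrier R" "b \<in> carrier R" "u \<in> carrier R - I" "v \<in> carrier R - I"
    "t \<in> carrier R - I" "t \<otimes> (a \<otimes> v) = t \<otimes> (b \<otimes> u)"
  shows "((a, u), (b, v)) \<in> loc_rel R I"
  using assms unfolding loc_rel_def by blast

lemma (in primeideal) equiv_loc_rel: "equiv (carrier R \<times> (carrier R - I)) (loc_rel R I)"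
proof (rule equivI)
  show "loc_rel R I \<subseteq> (carrier R \<times> (carrier R - I)) \<times> (carrier R \<times> (carrier R - I))"
    by (auto simp: loc_rel_def)
  show "refl_on (carrier R \<times> (carrier R - I)) (loc_rel R I)"
    by (auto intro!: refl_onI loc_relI[OF _ _ _ _ one_in_complement])
  show "sym (loc_rel R I)"
    by (rule symI) (clarsimp simp: loc_rel_def, metis Diff_iff)
  show "trans (loc_rel R I)"
  proof (rule transI, safe)
    fix a u b v c x assume "((a, u), (b, v)) \<in> loc_rel R I" "((b, v), (c, x)) \<in> loc_rel R I"
    then obtain t s where
      carr: "a \<in> carrier R" "b \<in> carrier R" "c \<in> carrier R" "u \<in> carrier R - I" "v \<in> carrier R - I"
      "x \<in> carrier R - I" "t \<in> carrier R - I" "s \<in> carrier R - I" and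
      eq: "t \<otimes> (a \<otimes> v) = t \<otimes> (b \<otimes> u)" "s \<otimes> (b \<otimes> x) = s \<otimes> (c \<otimes> v)"
      by (auto simp: loc_rel_def)
    then have mem: "t \<in> carrier R" "s \<in> carrier R" "u \<in> carrier R" "v \<in> carrier R" "x \<in> carrier R"
      by auto
    \<comment> \<open>The middle denominator \<open>v\<close> is not cancelled but joins the two
      witnesses as a factor; primality keeps \<open>t \<otimes> s \<otimes> v\<close> outside
      \<open>I\<close>.\<close>
    have "(t \<otimes> s \<otimes> v) \<otimes> (a \<otimes> x) = (t \<otimes> (a \<otimes> v)) \<otimes> (s \<otimes> x)"
      using carr(1-3) mem by (simp add: m_ac)
    also have "\<dots> = (s \<otimes> (b \<otimes> x)) \<otimes> (t \<otimes> u)"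
      using carr(1-3) mem by (simp add: eq(1)) (simp add: m_ac)
    also have "\<dots> = (t \<otimes> s \<otimes> v) \<otimes> (c \<otimes> u)"
      using carr(1-3) mem by (simp add: eq(2)) (simp add: m_ac)
    finally show "((a, u), (c, x)) \<in> loc_rel R I"
      using carr by (intro loc_relI[where t = "t \<otimes> s \<otimes> v"] mult_in_complement)
  qed
qed

lemma (in primeideal) loc_frac_eq_iff:
  assumes "a \<in> carrier R" "b \<in> carrier R" "u \<in> carrier R - I" "v \<in> carrier R - I"
  shows "loc_frac R I a u = loc_frac R I b v \<longleftrightarrow>
    (\<exists>t \<in> carrier R - I. t \<otimes> (a \<otimes> v) = t \<otimes> (b \<otimes> u))"
proof -
  have "loc_frac R I a u = loc_frac R I b v \<longleftrightarrow> ((a, u), (b, v)) \<in> loc_rel R I"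
    unfolding loc_frac_def using assms by (intro eq_equiv_class_iff[OF equiv_loc_rel]) auto
  then show ?thesis using assms by (auto simp: loc_rel_def)
qed

lemma (in primeideal) loc_frac_eqI:
  assumes "a \<in> carrier R" "b \<in> carrier R" "u \<in> carrier R - I" "v \<in> carrier R - I"
    "a \<otimes> v = b \<otimes> u"
  shows "loc_frac R I a u = loc_frac R I b v"
  using assms one_in_complement by (auto simp: loc_frac_eq_iff)

lemma (in primeideal) loc_frac_in_carrier:
  "a \<in> carrier R \<Longrightarrow> u \<in> carrier R - I \<Longrightarrow> loc_frac R I a u \<in> carrier (localization R I)"
  by (auto simp: localization_def loc_frac_def quotient_def)

lemma (in primeideal) localization_cases:
  assumes "X \<in> carrier (localization R I)"
  obtains a u where "a \<in> carrier R" "u \<in> carrier R - I" "X = loc_frac R I a u"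
  using assms by (auto simp: localization_def loc_frac_def quotient_def)

lemma (in primeideal) mem_loc_frac_iff:
  assumes "a \<in> carrier R" "u \<in> carrier R - I"
  shows "(b, v) \<in> loc_frac R I a u \<longleftrightarrow> b \<in> carrier R \<and> v \<in> carrier R - I \<and>
    (\<exists>t \<in> carrier R - I. t \<otimes> (a \<otimes> v) = t \<otimes> (b \<otimes> u))"
  using assms by (auto simp: loc_frac_def loc_rel_def)

lemma (in primeideal) self_mem_loc_frac:
  "a \<in> carrier R \<Longrightarrow> u \<in> carrier R - I \<Longrightarrow> (a, u) \<in> loc_frac R I a u"
  using one_in_complement by (auto simp: mem_loc_frac_iff)

text \<open>Independence of the representatives: multiplying the two defining equations gives one
  equation with witness \<open>t \<otimes> s\<close>.\<close>

lemma (in primeideal) loc_frac_mult: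
  assumes carr: "a \<in> carrier R" "b \<in> carrier R" "u \<in> carrier R - I" "v \<in> carrier R - I"
  shows "loc_frac R I a u \<otimes>\<^bsub>localization R I\<^esub> loc_frac R I b v = loc_frac R I (a \<otimes> b) (u \<otimes> v)"
proof -
  have "loc_frac R I (a' \<otimes> b') (u' \<otimes> v') = loc_frac R I (a \<otimes> b) (u \<otimes> v)"
    if "(a', u') \<in> loc_frac R I a u" "(b', v') \<in> loc_frac R I b v" for a' u' b' v'
  proof -
    from that carr obtain t s where
      carr': "a' \<in> carrier R" "b' \<in> carrier R" "u' \<in> carrier R - I" "v' \<in> carrier R - I"
        "t \<in> carrier R - I" "s \<in> carrier R - I" and
      eq: "t \<otimes> (a \<otimes> u') = t \<otimes> (a' \<otimes> u)" "s \<otimes> (b \<otimes> v') = s \<otimes> (b' \<otimes> v)"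
      by (auto simp: mem_loc_frac_iff)
    have mem: "t \<in> carrier R" "s \<in> carrier R" "u \<in> carrier R" "v \<in> carrier R"
      "u' \<in> carrier R" "v' \<in> carrier R" using carr carr' by auto
    have "(t \<otimes> s) \<otimes> ((a' \<otimes> b') \<otimes> (u \<otimes> v)) = (t \<otimes> (a' \<otimes> u)) \<otimes> (s \<otimes> (b' \<otimes> v))"
      using carr(1,2) carr'(1,2) mem by (simp add: m_ac)
    also have "\<dots> = (t \<otimes> (a \<otimes> u')) \<otimes> (s \<otimes> (b \<otimes> v'))" by (simp only: eq)
    also have "\<dots> = (t \<otimes> s) \<otimes> ((a \<otimes> b) \<otimes> (u' \<otimes> v'))"
      using carr(1,2) carr'(1,2) mem by (simp add: m_ac)
    finally show ?thesis
      using carr carr' mult_in_complement[OF carr'(5,6)] mult_in_complement[OF carr(3,4)]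
        mult_in_complement[OF carr'(3,4)] by (subst loc_frac_eq_iff) blast+
  qed
  then show ?thesis
    unfolding localization_def monoid.simps ring.simps
    by (intro UN_UN_const[OF self_mem_loc_frac[OF carr(1,3)] self_mem_loc_frac[OF carr(2,4)]])
qed

lemma (in primeideal) loc_frac_add:
  assumes carr: "a \<in> carrier R" "b \<in> carrier R" "u \<in> carrier R - I" "v \<in> carrier R - I"
  shows "loc_frac R I a u \<oplus>\<^bsub>localization R I\<^esub> loc_frac R I b v =
    loc_frac R I (a \<otimes> v \<oplus> b \<otimes> u) (u \<otimes> v)"
proof -
  have "loc_frac R I (a' \<otimes> v' \<oplus> b' \<otimes> u') (u' \<otimes> v') = loc_frac R I (a \<otimes> v \<oplus> b \<otimes> u) (u \<otimes> v)"
    if "(a', u') \<in> loc_frac R I a u" "(b', v') \<in> loc_frac R I b v" for a' u' b' v'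
  proof -
    from that carr obtain t s where
      carr': "a' \<in> carrier R" "b' \<in> carrier R" "u' \<in> carrier R - I" "v' \<in> carrier R - I"
        "t \<in> carrier R - I" "s \<in> carrier R - I" and
      eq: "t \<otimes> (a \<otimes> u') = t \<otimes> (a' \<otimes> u)" "s \<otimes> (b \<otimes> v') = s \<otimes> (b' \<otimes> v)"
      by (auto simp: mem_loc_frac_iff)
    have mem: "t \<in> carrier R" "s \<in> carrier R" "u \<in> carrier R" "v \<in> carrier R"
      "u' \<in> carrier R" "v' \<in> carrier R" using carr carr' by auto
    \<comment> \<open>Each summand contains one of the two defining equations, multiplied by the
      other witness and both denominators of the other fraction.\<close>
    have "(t \<otimes> s) \<otimes> ((a' \<otimes> v' \<oplus> b' \<otimes> u') \<otimes> (u \<otimes> v)) =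
        (t \<otimes> (a' \<otimes> u)) \<otimes> (s \<otimes> (v \<otimes> v')) \<oplus> (s \<otimes> (b' \<otimes> v)) \<otimes> (t \<otimes> (u \<otimes> u'))"
      using carr(1,2) carr'(1,2) mem by (simp add: l_distr r_distr m_ac)
    also have "\<dots> = (t \<otimes> (a \<otimes> u')) \<otimes> (s \<otimes> (v \<otimes> v')) \<oplus> (s \<otimes> (b \<otimes> v')) \<otimes> (t \<otimes> (u \<otimes> u'))"
      by (simp only: eq)
    also have "\<dots> = (t \<otimes> s) \<otimes> ((a \<otimes> v \<oplus> b \<otimes> u) \<otimes> (u' \<otimes> v'))"
      using carr(1,2) carr'(1,2) mem by (simp add: l_distr r_distr m_ac)
    finally show ?thesis
      using carr carr' mem mult_in_complement[OF carr'(5,6)] mult_in_complement[OF carr(3,4)]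
        mult_in_complement[OF carr'(3,4)] by (subst loc_frac_eq_iff) blast+
  qed
  then show ?thesis
    unfolding localization_def monoid.simps ring.simps
    by (intro UN_UN_const[OF self_mem_loc_frac[OF carr(1,3)] self_mem_loc_frac[OF carr(2,4)]])
qed

lemma (in primeideal) loc_one: "\<one>\<^bsub>localization R I\<^esub> = loc_frac R I \<one> \<one>"
  and loc_zero: "\<zero>\<^bsub>localization R I\<^esub> = loc_frac R I \<zero> \<one>"
  by (simp_all add: localization_def)

lemma (in primeideal) cring_localization: "cring (localization R I)"
proof (rule cringI)
  note simps = loc_frac_mult loc_frac_add loc_one loc_zero
  note intros = loc_frac_in_carrier mult_in_complement one_in_complement
  show "abelian_group (localization R I)"
  proof (rule abelian_groupI)
    fix X Y assume "X \<in> carrier (localization R I)" "Y \<in> carrier (localization R I)"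
    then obtain a u b v where *: "a \<in> carrier R" "u \<in> carrier R - I" "X = loc_frac R I a u"
      "b \<in> carrier R" "v \<in> carrier R - I" "Y = loc_frac R I b v" by (metis localization_cases)
    then have mem: "u \<in> carrier R" "v \<in> carrier R" by auto
    show "X \<oplus>\<^bsub>localization R I\<^esub> Y \<in> carrier (localization R I)"
      using * mem by (auto simp only: simps intro!: intros m_closed a_closed)
    show "X \<oplus>\<^bsub>localization R I\<^esub> Y = Y \<oplus>\<^bsub>localization R I\<^esub> X"
      using * mem by (simp add: simps a_comm m_comm)
  next
    show "\<zero>\<^bsub>localization R I\<^esub> \<in> carrier (localization R I)"
      by (simp only: simps intros zero_closed)
  next
    fix X Y Z assume "X \<in> carrier (localization R I)" "Y \<in> carrier (localization R I)"
      "Z \<in> carrier (localization R I)"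
    then obtain a u b v c x where *: "a \<in> carrier R" "u \<in> carrier R - I" "X = loc_frac R I a u"
      "b \<in> carrier R" "v \<in> carrier R - I" "Y = loc_frac R I b v"
      "c \<in> carrier R" "x \<in> carrier R - I" "Z = loc_frac R I c x" by (metis localization_cases)
    then have mem: "u \<in> carrier R" "v \<in> carrier R" "x \<in> carrier R" by auto
    have "u \<otimes> v \<in> carrier R - I" "v \<otimes> x \<in> carrier R - I"
      using * mult_in_complement by blast+
    then show "X \<oplus>\<^bsub>localization R I\<^esub> Y \<oplus>\<^bsub>localization R I\<^esub> Z =
        X \<oplus>\<^bsub>localization R I\<^esub> (Y \<oplus>\<^bsub>localization R I\<^esub> Z)"
      using * mem by (simp only: simps m_closed a_closed) (simp add: l_distr r_distr m_ac a_ac)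
  next
    fix X assume "X \<in> carrier (localization R I)"
    then obtain a u where *: "a \<in> carrier R" "u \<in> carrier R - I" "X = loc_frac R I a u"
      by (metis localization_cases)
    then have mem: "u \<in> carrier R" by auto
    show "\<zero>\<^bsub>localization R I\<^esub> \<oplus>\<^bsub>localization R I\<^esub> X = X"
      using * mem one_in_complement by (simp add: simps)
    have "loc_frac R I (\<ominus> a) u \<oplus>\<^bsub>localization R I\<^esub> X = loc_frac R I ((\<ominus> a \<oplus> a) \<otimes> u) (u \<otimes> u)"
      using * mem by (simp only: simps a_inv_closed l_distr)
    also have "\<dots> = \<zero>\<^bsub>localization R I\<^esub>"
      using * mem mult_in_complement[of u u] one_in_complement unfolding simps
      by (intro loc_frac_eqI) (auto simp: l_neg)
    finally show "\<exists>y\<in>carrier (localization R I). y \<oplus>\<^bsub>localization R I\<^esub> X = \<zero>\<^bsub>localization R I\<^esub>"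
      using * by (intro bexI[of _ "loc_frac R I (\<ominus> a) u"] intros) auto
  qed
  show "comm_monoid (localization R I)"
  proof (rule comm_monoidI)
    fix X Y assume "X \<in> carrier (localization R I)" "Y \<in> carrier (localization R I)"
    then obtain a u b v where *: "a \<in> carrier R" "u \<in> carrier R - I" "X = loc_frac R I a u"
      "b \<in> carrier R" "v \<in> carrier R - I" "Y = loc_frac R I b v" by (metis localization_cases)
    then have mem: "u \<in> carrier R" "v \<in> carrier R" by auto
    show "X \<otimes>\<^bsub>localization R I\<^esub> Y \<in> carrier (localization R I)"
      using * mem by (auto simp only: simps intro!: intros m_closed a_closed)
    show "X \<otimes>\<^bsub>localization R I\<^esub> Y = Y \<otimes>\<^bsub>localization R I\<^esub> X"
      using * mem by (simp add: simps m_comm)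
  next
    show "\<one>\<^bsub>localization R I\<^esub> \<in> carrier (localization R I)"
      by (simp only: simps intros one_closed)
  next
    fix X Y Z assume "X \<in> carrier (localization R I)" "Y \<in> carrier (localization R I)"
      "Z \<in> carrier (localization R I)"
    then obtain a u b v c x where *: "a \<in> carrier R" "u \<in> carrier R - I" "X = loc_frac R I a u"
      "b \<in> carrier R" "v \<in> carrier R - I" "Y = loc_frac R I b v"
      "c \<in> carrier R" "x \<in> carrier R - I" "Z = loc_frac R I c x" by (metis localization_cases)
    then have mem: "u \<in> carrier R" "v \<in> carrier R" "x \<in> carrier R" by auto
    have "u \<otimes> v \<in> carrier R - I" "v \<otimes> x \<in> carrier R - I"
      using * mult_in_complement by blast+
    then show "X \<otimes>\<^bsub>localization R I\<^esub> Y \<otimes>\<^bsub>localization R I\<^esub> Z =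
        X \<otimes>\<^bsub>localization R I\<^esub> (Y \<otimes>\<^bsub>localization R I\<^esub> Z)"
      using * mem by (simp only: simps m_closed) (simp add: m_ac)
  next
    fix X assume "X \<in> carrier (localization R I)"
    then obtain a u where *: "a \<in> carrier R" "u \<in> carrier R - I" "X = loc_frac R I a u"
      by (metis localization_cases)
    then show "\<one>\<^bsub>localization R I\<^esub> \<otimes>\<^bsub>localization R I\<^esub> X = X"
      using one_in_complement by (simp add: simps)
  qed
  fix X Y Z assume "X \<in> carrier (localization R I)" "Y \<in> carrier (localization R I)"
    "Z \<in> carrier (localization R I)"
  then obtain a u b v c x where *: "a \<in> carrier R" "u \<in> carrier R - I" "X = loc_frac R I a u"
    "b \<in> carrier R" "v \<in> carrier R - I" "Y = loc_frac R I b v"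
    "c \<in> carrier R" "x \<in> carrier R - I" "Z = loc_frac R I c x" by (metis localization_cases)
  then have mem: "u \<in> carrier R" "v \<in> carrier R" "x \<in> carrier R" by auto
  have prods: "u \<otimes> v \<in> carrier R - I" "u \<otimes> x \<in> carrier R - I" "v \<otimes> x \<in> carrier R - I"
    using * mult_in_complement by blast+
  define N where "N = (a \<otimes> v \<oplus> b \<otimes> u) \<otimes> c"
  have N: "N \<in> carrier R" using * mem by (simp add: N_def)
  have "a \<otimes> c \<otimes> (v \<otimes> x) \<oplus> b \<otimes> c \<otimes> (u \<otimes> x) = N \<otimes> x"
    using * mem by (simp add: N_def l_distr r_distr m_ac)
  then have "X \<otimes>\<^bsub>localization R I\<^esub> Z \<oplus>\<^bsub>localization R I\<^esub> Y \<otimes>\<^bsub>localization R I\<^esub> Z =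
      loc_frac R I (N \<otimes> x) (u \<otimes> x \<otimes> (v \<otimes> x))"
    using * prods by (simp only: simps m_closed)
  also have "\<dots> = loc_frac R I N (u \<otimes> v \<otimes> x)"
  proof (rule loc_frac_eqI)
    show "N \<otimes> x \<otimes> (u \<otimes> v \<otimes> x) = N \<otimes> (u \<otimes> x \<otimes> (v \<otimes> x))"
      using N mem by (simp add: m_ac)
  qed (use * N mem prods mult_in_complement in blast)+
  also have "\<dots> = (X \<oplus>\<^bsub>localization R I\<^esub> Y) \<otimes>\<^bsub>localization R I\<^esub> Z"
    using * mem prods unfolding N_def by (simp only: simps m_closed a_closed)
  finally show "(X \<oplus>\<^bsub>localization R I\<^esub> Y) \<otimes>\<^bsub>localization R I\<^esub> Z =
      X \<otimes>\<^bsub>localization R I\<^esub> Z \<oplus>\<^bsub>localization R I\<^esub> Y \<otimes>\<^bsub>localization R I\<^esub> Z" ..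
qed

section \<open>Extension and contraction of ideals\<close>

lemma (in primeideal) mem_extend_contractI:
  assumes "f \<in> carrier R" "u \<in> carrier R - I" "J \<subseteq> carrier R" "u \<otimes> f \<in> J"
  shows "f \<in> extend_contract R I J"
proof -
  have "to_localization R I f \<in> K"
    if "ideal K (localization R I)" "to_localization R I ` J \<subseteq> K" for K
  proof -
    have "loc_frac R I (u \<otimes> f) \<one> \<in> K"
      using that(2) assms(4) by (auto simp: to_localization_def)
    \<comment> \<open>The fraction f/1 is 1/u times (u f)/1, and \<open>u\<close> is a legitimate
      denominator.\<close>
    then have "loc_frac R I \<one> u \<otimes>\<^bsub>localization R I\<^esub> loc_frac R I (u \<otimes> f) \<one> \<in> K"
      using ideal.I_l_closed[OF that(1)] loc_frac_in_carrier assms by auto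
    also have "loc_frac R I \<one> u \<otimes>\<^bsub>localization R I\<^esub> loc_frac R I (u \<otimes> f) \<one> = to_localization R I f"
      using assms one_in_complement unfolding to_localization_def
      by (subst loc_frac_mult) (auto simp: m_comm intro!: loc_frac_eqI del: equalityI)
    finally show ?thesis .
  qed
  then show ?thesis
    using assms(1) by (auto simp: extend_contract_def genideal_def)
qed

text \<open>Every ideal that contains the image of \<open>J\<close> bounds the extension of
  \<open>J\<close> from above; this one makes membership explicit.\<close>

lemma (in primeideal) ideal_localized:
  assumes "ideal J R"
  shows "ideal {loc_frac R I a u | a u. a \<in> J \<and> u \<in> carrier R - I} (localization R I)"
    (is "ideal ?K _")
proof (rule idealI)
  interpret J: ideal J R by fact
  interpret L: cring "localization R I" by (rule cring_localization)
  show "ring (localization R I)" by (rule L.ring_axioms)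
  have sub: "?K \<subseteq> carrier (localization R I)"
    using loc_frac_in_carrier J.Icarr by auto
  have lmult: "x \<otimes>\<^bsub>localization R I\<^esub> y \<in> ?K"
    if "y \<in> ?K" "x \<in> carrier (localization R I)" for x y
  proof -
    from that obtain a u b v where "a \<in> J" "u \<in> carrier R - I" "y = loc_frac R I a u"
      "b \<in> carrier R" "v \<in> carrier R - I" "x = loc_frac R I b v"
      by (auto elim: localization_cases)
    then show ?thesis
      using J.I_l_closed mult_in_complement J.Icarr by (auto simp: loc_frac_mult) blast
  qed
  then show "x \<otimes>\<^bsub>localization R I\<^esub> y \<in> ?K" "y \<otimes>\<^bsub>localization R I\<^esub> x \<in> ?K"
    if "y \<in> ?K" "x \<in> carrier (localization R I)" for x y
    using that sub L.m_comm by (metis (no_types, lifting) subsetD)+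
  show "subgroup ?K (add_monoid (localization R I))"
  proof (rule L.add.subgroupI)
    show "?K \<subseteq> carrier (localization R I)" by (rule sub)
    show "?K \<noteq> {}" using J.zero_closed one_in_complement by blast
    show "\<ominus>\<^bsub>localization R I\<^esub> x \<in> ?K" if "x \<in> ?K" for x
    proof -
      \<comment> \<open>Negation is multiplication by minus one, so \<open>lmult\<close> covers
        it.\<close>
      have "\<ominus>\<^bsub>localization R I\<^esub> x = (\<ominus>\<^bsub>localization R I\<^esub> \<one>\<^bsub>localization R I\<^esub>) \<otimes>\<^bsub>localization R I\<^esub> x"
        using that sub by (simp add: L.l_minus subset_iff)
      then show ?thesis using lmult[OF that] by simp
    qed
    show "x \<oplus>\<^bsub>localization R I\<^esub> y \<in> ?K" if "x \<in> ?K" "y \<in> ?K" for x y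
    proof -
      from that obtain a u b v where *: "a \<in> J" "u \<in> carrier R - I" "x = loc_frac R I a u"
        "b \<in> J" "v \<in> carrier R - I" "y = loc_frac R I b v"
        by auto
      then have "x \<oplus>\<^bsub>localization R I\<^esub> y = loc_frac R I (a \<otimes> v \<oplus> b \<otimes> u) (u \<otimes> v)"
        by (simp add: loc_frac_add J.Icarr)
      moreover have "a \<otimes> v \<oplus> b \<otimes> u \<in> J" using * by (intro J.a_closed J.I_r_closed) auto
      ultimately show ?thesis using mult_in_complement * by blast
    qed
  qed
qed

text \<open>The extension lies in the ideal of fractions with numerator in \<open>J\<close>.
  Equality of f/1 with such a fraction a/u means
  \<open>t \<otimes> (f \<otimes> u) = t \<otimes> a\<close> for some \<open>t\<close> outside
  \<open>I\<close>, so \<open>t \<otimes> u\<close> is the multiplier.\<close>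

lemma (in primeideal) mem_extend_contractD:
  assumes "ideal J R" "f \<in> extend_contract R I J"
  obtains u where "u \<in> carrier R - I" "u \<otimes> f \<in> J"
proof -
  interpret J: ideal J R by fact
  let ?K = "{loc_frac R I a u | a u. a \<in> J \<and> u \<in> carrier R - I}"
  have "to_localization R I ` J \<subseteq> ?K"
    using one_in_complement by (auto simp: to_localization_def)
  then have "loc_frac R I f \<one> \<in> ?K" and f: "f \<in> carrier R"
    using assms(2) ideal_localized[OF assms(1)]
    by (auto simp: extend_contract_def genideal_def to_localization_def)
  then obtain a u where au: "a \<in> J" "u \<in> carrier R - I" "loc_frac R I f \<one> = loc_frac R I a u"
    by auto
  then obtain t where t: "t \<in> carrier R - I" "t \<otimes> (f \<otimes> u) = t \<otimes> (a \<otimes> \<one>)"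
    using f one_in_complement J.Icarr by (auto simp: loc_frac_eq_iff)
  have "(t \<otimes> u) \<otimes> f = t \<otimes> a"
    using t au f J.Icarr by (metis Diff_iff m_assoc m_comm r_one)
  then show ?thesis
    using that[of "t \<otimes> u"] mult_in_complement au t J.I_l_closed by auto
qed

section \<open>Monomial ideals\<close>

lemma (in ideal) mem_quot_annihilator_iff:
  assumes "g \<in> carrier R"
  shows "r \<in> quot_annihilator R I (I +> g) \<longleftrightarrow> r \<in> carrier R \<and> r \<otimes> g \<in> I"
proof -
  have "(I +> r) \<otimes>\<^bsub>R Quot I\<^esub> (I +> g) = \<zero>\<^bsub>R Quot I\<^esub> \<longleftrightarrow> r \<otimes> g \<in> I" if "r \<in> carrier R"
  proof -
    have "(I +> r) \<otimes>\<^bsub>R Quot I\<^esub> (I +> g) = I +> (r \<otimes> g)"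
      using assms that by (simp add: FactRing_def rcoset_mult_add)
    then show ?thesis
      using assms that a_rcos_self[of "r \<otimes> g"] a_rcos_const[of "r \<otimes> g"]
      by (auto simp: FactRing_def)
  qed
  then show ?thesis by (auto simp: quot_annihilator_def)
qed

lemma (in ideal) quot_carrier_cases:
  assumes "m \<in> carrier (R Quot I)"
  obtains g where "g \<in> carrier R" "m = I +> g"
  using assms by (auto simp: FactRing_def A_RCOSETS_defs a_r_coset_def)

section \<open>Polynomials with exponents in a given set\<close>

lemma keys_mult_cases:
  assumes "m \<in> Poly_Mapping.keys (p * q)"
  obtains a b where "a \<in> Poly_Mapping.keys p" "b \<in> Poly_Mapping.keys q" "m = a + b"
  using assms keys_mult[of p q] by blast

lemma keys_add_nat: "Poly_Mapping.keys (a + b) = Poly_Mapping.keys a \<union> Poly_Mapping.keys b"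
  for a b :: "'v \<Rightarrow>\<^sub>0 nat"
  by (auto simp: in_keys_iff lookup_add)

text \<open>An ideal arises once \<open>S\<close> is closed under adding exponent vectors. The
  choices \<open>UNIV\<close>, \<open>- {0}\<close> and \<open>power_expos G s\<close> give the
  whole ring, the irrelevant ideal and the powers of an ideal generated by monomials.\<close>

definition monomial_ideal :: "'v set \<Rightarrow> ('v \<Rightarrow>\<^sub>0 nat) set \<Rightarrow> ('v, 'k::field) mpoly set" where
  "monomial_ideal V S = {p. \<forall>m \<in> Poly_Mapping.keys p. Poly_Mapping.keys m \<subseteq> V \<and> m \<in> S}"

lemma carrier_poly_ring: "carrier (poly_ring V) = monomial_ideal V UNIV"
  by (simp add: poly_ring_def monomial_ideal_def)

lemma poly_ring_simps [simp]:
  "x \<otimes>\<^bsub>poly_ring V\<^esub> y = x * y" "x \<oplus>\<^bsub>poly_ring V\<^esub> y = x + y"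
  "\<one>\<^bsub>poly_ring V\<^esub> = 1" "\<zero>\<^bsub>poly_ring V\<^esub> = 0"
  by (simp_all add: poly_ring_def)

lemma zero_mem_monomial_ideal [simp]: "0 \<in> monomial_ideal V S"
  by (simp add: monomial_ideal_def)

lemma add_mem_monomial_ideal:
  "p \<in> monomial_ideal V S \<Longrightarrow> q \<in> monomial_ideal V S \<Longrightarrow> p + q \<in> monomial_ideal V S"
  using keys_add[of p q] by (auto simp: monomial_ideal_def)

lemma uminus_mem_monomial_ideal: "p \<in> monomial_ideal V S \<Longrightarrow> - p \<in> monomial_ideal V S"
  by (simp add: monomial_ideal_def in_keys_iff)

lemma mult_mem_monomial_ideal:
  assumes "p \<in> monomial_ideal V S" "q \<in> monomial_ideal V T"
    "\<And>a b. a \<in> S \<Longrightarrow> b \<in> T \<Longrightarrow> a + b \<in> U"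
  shows "p * q \<in> monomial_ideal V U"
  using assms by (fastforce simp: monomial_ideal_def keys_add_nat elim!: keys_mult_cases)

lemma monomial_mem_monomial_ideal:
  "Poly_Mapping.single m c \<in> monomial_ideal V S \<longleftrightarrow> c = 0 \<or> Poly_Mapping.keys m \<subseteq> V \<and> m \<in> S"
  by (simp add: monomial_ideal_def)

lemma monomial_ideal_mono: "S \<subseteq> T \<Longrightarrow> monomial_ideal V S \<subseteq> monomial_ideal V T"
  by (auto simp: monomial_ideal_def)

lemma cring_poly_ring: "cring (poly_ring V :: ('v, 'k::field) mpoly ring)"
proof (rule cringI)
  show "abelian_group (poly_ring V :: ('v, 'k) mpoly ring)"
  proof (rule abelian_groupI)
    fix x :: "('v, 'k) mpoly" assume "x \<in> carrier (poly_ring V)"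
    then show "\<exists>y \<in> carrier (poly_ring V). y \<oplus>\<^bsub>poly_ring V\<^esub> x = \<zero>\<^bsub>poly_ring V\<^esub>"
      by (intro bexI[of _ "- x"]) (auto simp: carrier_poly_ring uminus_mem_monomial_ideal)
  qed (auto simp: carrier_poly_ring add_mem_monomial_ideal ac_simps)
  show "comm_monoid (poly_ring V :: ('v, 'k) mpoly ring)"
    by (rule comm_monoidI)
      (auto simp: carrier_poly_ring ac_simps monomial_mem_monomial_ideal[of 0 1, simplified]
        intro: mult_mem_monomial_ideal)
qed (simp add: algebra_simps)

lemma ideal_monomial_ideal:
  assumes "\<And>a b. a \<in> S \<Longrightarrow> a + b \<in> S"
  shows "ideal (monomial_ideal V S) (poly_ring V :: ('v, 'k::field) mpoly ring)"
proof (rule idealI)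
  interpret R: cring "poly_ring V :: ('v, 'k) mpoly ring" by (rule cring_poly_ring)
  show "ring (poly_ring V :: ('v, 'k) mpoly ring)" by (rule R.ring_axioms)
  show "subgroup (monomial_ideal V S) (add_monoid (poly_ring V :: ('v, 'k) mpoly ring))"
  proof (rule R.add.subgroupI)
    fix x :: "('v, 'k) mpoly" assume x: "x \<in> monomial_ideal V S"
    have "\<ominus>\<^bsub>poly_ring V\<^esub> x = - x"
      using x monomial_ideal_mono[of S UNIV V]
      by (intro R.minus_equality) (auto simp: carrier_poly_ring uminus_mem_monomial_ideal)
    then show "\<ominus>\<^bsub>poly_ring V\<^esub> x \<in> monomial_ideal V S" using x by (simp add: uminus_mem_monomial_ideal)
  next
    show "monomial_ideal V S \<subseteq> carrier (poly_ring V :: ('v, 'k) mpoly ring)"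
      using monomial_ideal_mono[of S UNIV V] by (auto simp: carrier_poly_ring)
  next
    show "monomial_ideal V S \<noteq> {}" using zero_mem_monomial_ideal by blast
  qed (simp add: add_mem_monomial_ideal)
  fix a x :: "('v, 'k) mpoly" assume "a \<in> monomial_ideal V S" "x \<in> carrier (poly_ring V)"
  then show "a \<otimes>\<^bsub>poly_ring V\<^esub> x \<in> monomial_ideal V S"
    using assms by (auto simp: carrier_poly_ring intro: mult_mem_monomial_ideal)
  then show "x \<otimes>\<^bsub>poly_ring V\<^esub> a \<in> monomial_ideal V S" by (simp add: mult.commute)
qed

text \<open>A polynomial is the sum of its terms, so additive closure reduces the inclusion to
  single terms.\<close>

lemma monomial_ideal_subset:
  fixes A :: "('v, 'k::field) mpoly set"
  assumes "0 \<in> A" "\<And>p q. p \<in> A \<Longrightarrow> q \<in> A \<Longrightarrow> p + q \<in> A"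
    and "\<And>m c. Poly_Mapping.keys m \<subseteq> V \<Longrightarrow> m \<in> S \<Longrightarrow> Poly_Mapping.single m c \<in> A"
  shows "monomial_ideal V S \<subseteq> A"
proof
  fix p :: "('v, 'k) mpoly" assume "p \<in> monomial_ideal V S"
  then show "p \<in> A"
  proof (induction p rule: update_induct)
    case const
    then show ?case using assms(1) by simp
  next
    case (update f a b)
    have "Poly_Mapping.update a b f = Poly_Mapping.single a b + f"
      using update(1)
      by (intro poly_mapping_eqI) (auto simp: lookup_update lookup_add lookup_single in_keys_iff when_def)
    moreover have "f \<in> A" "Poly_Mapping.single a b \<in> A"
      using update by (auto simp: monomial_ideal_def keys_update intro: assms(3))
    ultimately show ?case using assms(2) by simp
  qed
qed

text \<open>The convolution contributes at most once to the coefficient at \<open>k + l\<close>, so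
  nothing can cancel. All arguments about surviving terms rest on this.\<close>

lemma lookup_mult_unique:
  fixes p q :: "('v, 'k::field) mpoly"
  assumes "\<And>a b. a \<in> Poly_Mapping.keys p \<Longrightarrow> b \<in> Poly_Mapping.keys q \<Longrightarrow> a + b = k + l \<Longrightarrow>
    a = k \<and> b = l"
  shows "Poly_Mapping.lookup (p * q) (k + l) = Poly_Mapping.lookup p k * Poly_Mapping.lookup q l"
proof -
  have "Poly_Mapping.lookup p a * (\<Sum>b. Poly_Mapping.lookup q b when k + l = a + b) =
      (Poly_Mapping.lookup p k * Poly_Mapping.lookup q l when a = k)" for a
  proof (cases "a \<in> Poly_Mapping.keys p")
    case True
    have "(Poly_Mapping.lookup q b when k + l = a + b) =
        ((Poly_Mapping.lookup q l when a = k) when b = l)" for b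
      using assms[OF True, of b] by (cases "b \<in> Poly_Mapping.keys q") (auto simp: when_def in_keys_iff)
    then show ?thesis by (simp add: when_def)
  next
    case False
    then show ?thesis by (auto simp: when_def in_keys_iff)
  qed
  then show ?thesis by (simp add: lookup_mult)
qed

text \<open>Exponents of the monomials divisible by a product of \<open>s\<close> generators.
  Starting from \<open>UNIV\<close> encodes the unit ideal and makes every level closed under
  multiples.\<close>

primrec power_expos :: "('v \<Rightarrow>\<^sub>0 nat) set \<Rightarrow> nat \<Rightarrow> ('v \<Rightarrow>\<^sub>0 nat) set" where
  "power_expos G 0 = UNIV"
| "power_expos G (Suc s) = {g + m | g m. g \<in> G \<and> m \<in> power_expos G s}"

lemma power_expos_up: "a \<in> power_expos G s \<Longrightarrow> a + b \<in> power_expos G s"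
proof (induction s arbitrary: a)
  case (Suc s)
  then obtain g m where "g \<in> G" "m + b \<in> power_expos G s" "a = g + m"
    by auto
  then have "a + b = g + (m + b)" "g \<in> G" "m + b \<in> power_expos G s" by (simp_all add: ac_simps)
  then show ?case by auto
qed simp

lemma power_expos_add:
  "a \<in> power_expos G s \<Longrightarrow> b \<in> power_expos G t \<Longrightarrow> a + b \<in> power_expos G (s + t)"
proof (induction s arbitrary: a)
  case 0
  then show ?case using power_expos_up[of b G t a] by (simp add: ac_simps)
next
  case (Suc s)
  then obtain g m where "g \<in> G" "m + b \<in> power_expos G (s + t)" "a = g + m"
    by auto
  then have "a + b = g + (m + b)" "g \<in> G" "m + b \<in> power_expos G (s + t)"
    by (simp_all add: ac_simps)
  then show ?case by auto
qed

lemma mem_power_expos_1: "g \<in> G \<Longrightarrow> g \<in> power_expos G 1"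
proof -
  assume "g \<in> G"
  moreover have "g = g + 0" by simp
  ultimately show ?thesis unfolding One_nat_def power_expos.simps by blast
qed

lemma ideal_power_expos:
  "ideal (monomial_ideal V (power_expos G s)) (poly_ring V :: ('v, 'k::field) mpoly ring)"
  by (rule ideal_monomial_ideal) (rule power_expos_up)

lemma genideal_monomials:
  fixes V :: "'v set"
  assumes "\<And>g. g \<in> G \<Longrightarrow> Poly_Mapping.keys g \<subseteq> V"
  shows "Idl\<^bsub>poly_ring V\<^esub> ((\<lambda>g. Poly_Mapping.single g 1) ` G) =
    (monomial_ideal V (power_expos G 1) :: ('v, 'k::field) mpoly set)"
    (is "Idl\<^bsub>?R\<^esub> ?X = ?M")
proof
  interpret R: cring ?R by (rule cring_poly_ring)
  have X: "?X \<subseteq> ?M"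
    using assms mem_power_expos_1 by (auto simp: monomial_mem_monomial_ideal)
  then show "Idl\<^bsub>?R\<^esub> ?X \<subseteq> ?M"
    by (intro R.genideal_minimal ideal_power_expos)
  have "?X \<subseteq> carrier ?R"
    using assms by (auto simp: carrier_poly_ring monomial_mem_monomial_ideal)
  then interpret X: ideal "Idl\<^bsub>?R\<^esub> ?X" ?R by (rule R.genideal_ideal)
  show "?M \<subseteq> Idl\<^bsub>?R\<^esub> ?X"
  proof (rule monomial_ideal_subset)
    show "0 \<in> Idl\<^bsub>?R\<^esub> ?X" using X.zero_closed by simp
    show "p + q \<in> Idl\<^bsub>?R\<^esub> ?X" if "p \<in> Idl\<^bsub>?R\<^esub> ?X" "q \<in> Idl\<^bsub>?R\<^esub> ?X" for p q
      using X.a_closed[OF that] by simp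
    fix m and c :: 'k assume m: "Poly_Mapping.keys m \<subseteq> V" "m \<in> power_expos G 1"
    then obtain g b where g: "g \<in> G" "m = g + b" by auto
    then have "Poly_Mapping.single g 1 \<in> Idl\<^bsub>?R\<^esub> ?X"
      using R.genideal_self[OF \<open>?X \<subseteq> carrier ?R\<close>] by auto
    \<comment> \<open>Exponents do not cancel, so the cofactor \<open>b\<close> involves only
      variables of \<open>m\<close> and belongs to the ring.\<close>
    then have "Poly_Mapping.single g 1 * Poly_Mapping.single b c \<in> Idl\<^bsub>?R\<^esub> ?X"
      using X.I_r_closed[of _ "Poly_Mapping.single b c"] m g
      by (auto simp: carrier_poly_ring monomial_mem_monomial_ideal keys_add_nat)
    then show "Poly_Mapping.single m c \<in> Idl\<^bsub>?R\<^esub> ?X" by (simp add: mult_single g)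
  qed
qed

lemma monomial_ideal_power:
  fixes V :: "'v set"
  assumes "\<And>g. g \<in> G \<Longrightarrow> Poly_Mapping.keys g \<subseteq> V"
  shows "(monomial_ideal V (power_expos G 1) :: ('v, 'k::field) mpoly set)
      [^]\<^bsub>ideals_set (poly_ring V)\<^esub> s = monomial_ideal V (power_expos G s)"
proof (induction s)
  case 0
  \<comment> \<open>The unit in the monoid of ideals is the whole ring, matching
    \<open>power_expos G 0 = UNIV\<close>.\<close>
  then show ?case by (simp add: ideals_set_def carrier_poly_ring)
next
  case (Suc s)
  let ?R = "poly_ring V :: ('v, 'k) mpoly ring"
  let ?P = "monomial_ideal V (power_expos G s) \<cdot>\<^bsub>?R\<^esub> monomial_ideal V (power_expos G 1)"
  have "?P = monomial_ideal V (power_expos G (Suc s))"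
  proof
    show "?P \<subseteq> monomial_ideal V (power_expos G (Suc s))"
    proof
      fix p assume "p \<in> ?P"
      then show "p \<in> monomial_ideal V (power_expos G (Suc s))"
      proof induction
        case (prod i j)
        have "a + b \<in> power_expos G (Suc s)"
          if "a \<in> power_expos G s" "b \<in> power_expos G 1" for a b
          using power_expos_add[OF that] by (simp only: add_Suc_right One_nat_def add_0_right)
        then show ?case
          using mult_mem_monomial_ideal[OF prod] by (simp only: poly_ring_simps)
      qed (simp add: add_mem_monomial_ideal)
    qed
    show "monomial_ideal V (power_expos G (Suc s)) \<subseteq> ?P"
    proof (rule monomial_ideal_subset)
      show "0 \<in> ?P"
        using ideal_prod.prod[of 0 "monomial_ideal V (power_expos G s)" 0
            "monomial_ideal V (power_expos G 1)" ?R] by simp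
      show "p + q \<in> ?P" if "p \<in> ?P" "q \<in> ?P" for p q
        using ideal_prod.sum[OF that] by simp
      fix m and c :: 'k assume m: "Poly_Mapping.keys m \<subseteq> V" "m \<in> power_expos G (Suc s)"
      then obtain g b where g: "g \<in> G" "m = g + b" "b \<in> power_expos G s" by auto
      have "Poly_Mapping.single b c * Poly_Mapping.single g 1 \<in> ?P"
        using ideal_prod.prod[of "Poly_Mapping.single b c" "monomial_ideal V (power_expos G s)"
            "Poly_Mapping.single g 1" "monomial_ideal V (power_expos G 1)" ?R] m(1) g
          assms[OF g(1)] mem_power_expos_1[OF g(1)]
        by (simp add: monomial_mem_monomial_ideal keys_add_nat del: power_expos.simps One_nat_def)
      then show "Poly_Mapping.single m c \<in> ?P" by (simp add: mult_single g ac_simps)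
    qed
  qed
  then show ?case using Suc by (simp add: ideals_set_def)
qed

text \<open>Multiplication by a monomial shifts exponents injectively, so every term
  survives.\<close>

lemma mem_monomial_ideal_monomial_mult:
  assumes "Poly_Mapping.single m 1 * p \<in> monomial_ideal V S" "k \<in> Poly_Mapping.keys p"
  shows "m + k \<in> S"
proof -
  have "Poly_Mapping.lookup (Poly_Mapping.single m 1 * p) (m + k) = Poly_Mapping.lookup p k"
    by (subst lookup_mult_unique) auto
  then show ?thesis using assms by (auto simp: monomial_ideal_def in_keys_iff)
qed

section \<open>The irrelevant maximal ideal\<close>

text \<open>A sum of exponent vectors vanishes only if both do. Since the constant term is therefore
  multiplicative, the polynomials without constant term form a prime ideal.\<close>

lemma lookup_mult_zero:
  "Poly_Mapping.lookup (p * q) 0 = Poly_Mapping.lookup p 0 * Poly_Mapping.lookup q 0"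
  for p q :: "('v, 'k::field) mpoly"
proof -
  have zero: "a = 0 \<and> b = 0" if "a + b = 0 + 0" for a b :: "'v \<Rightarrow>\<^sub>0 nat"
    using that by (metis add_0 keys_add_nat keys_zero keys_eq_empty Un_empty)
  have "Poly_Mapping.lookup (p * q) (0 + 0) = Poly_Mapping.lookup p 0 * Poly_Mapping.lookup q 0"
    by (rule lookup_mult_unique, rule zero)
  then show ?thesis by simp
qed

lemma mem_irrelevant_iff:
  "p \<in> monomial_ideal V (- {0}) \<longleftrightarrow> p \<in> monomial_ideal V UNIV \<and> Poly_Mapping.lookup p 0 = 0"
  by (auto simp: monomial_ideal_def in_keys_iff)

lemma primeideal_irrelevant:
  "primeideal (monomial_ideal V (- {0})) (poly_ring V :: ('v, 'k::field) mpoly ring)"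
proof (rule primeidealI)
  show "ideal (monomial_ideal V (- {0})) (poly_ring V :: ('v, 'k) mpoly ring)"
  proof (rule ideal_monomial_ideal)
    show "a + b \<in> - {0}" if "a \<in> - {0}" for a b :: "'v \<Rightarrow>\<^sub>0 nat"
      using that by (metis ComplD ComplI Un_empty keys_add_nat keys_eq_empty singleton_iff)
  qed
  show "carrier (poly_ring V) \<noteq> (monomial_ideal V (- {0}) :: ('v, 'k) mpoly set)"
  proof
    assume "carrier (poly_ring V) = (monomial_ideal V (- {0}) :: ('v, 'k) mpoly set)"
    moreover have "(1 :: ('v, 'k) mpoly) \<in> carrier (poly_ring V)"
      "(1 :: ('v, 'k) mpoly) \<notin> monomial_ideal V (- {0})"
      by (simp_all add: carrier_poly_ring monomial_ideal_def)
    ultimately show False by blast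
  qed
  fix a b :: "('v, 'k) mpoly"
  assume "a \<in> carrier (poly_ring V)" "b \<in> carrier (poly_ring V)"
    "a \<otimes>\<^bsub>poly_ring V\<^esub> b \<in> monomial_ideal V (- {0})"
  then show "a \<in> monomial_ideal V (- {0}) \<or> b \<in> monomial_ideal V (- {0})"
    by (simp add: mem_irrelevant_iff lookup_mult_zero carrier_poly_ring)
qed (rule cring_poly_ring)

text \<open>If \<open>u\<close> has a nonzero constant term, then a term of \<open>f\<close> of lowest degree among those outside
  \<open>S\<close> survives in \<open>u * f\<close>.\<close>

lemma mem_monomial_ideal_of_unit_mult:
  fixes f u :: "('v, 'k::field) mpoly"
  assumes S: "\<And>a b. a \<in> S \<Longrightarrow> a + b \<in> S" and f: "f \<in> monomial_ideal V UNIV"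
    and u: "Poly_Mapping.lookup u 0 \<noteq> 0" and uf: "u * f \<in> monomial_ideal V S"
  shows "f \<in> monomial_ideal V S"
proof (rule ccontr)
  define deg :: "('v \<Rightarrow>\<^sub>0 nat) \<Rightarrow> nat" where "deg m = (\<Sum>x \<in> Poly_Mapping.keys m. Poly_Mapping.lookup m x)" for m
  have deg_add: "deg (a + b) = deg a + deg b" for a b
    unfolding deg_def by (rule setsum_keys_plus_distrib[of "\<lambda>_ x. x" a b]) auto
  have deg_0: "a = 0" if "deg a = 0" for a
    using that by (auto simp: deg_def in_keys_iff intro: poly_mapping_eqI)
  assume "f \<notin> monomial_ideal V S"
  then obtain k where "k \<in> Poly_Mapping.keys f" "k \<notin> S"
    using f by (auto simp: monomial_ideal_def)
  then obtain m where m: "m \<in> Poly_Mapping.keys f" "m \<notin> S"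
    and least: "\<And>b. b \<in> Poly_Mapping.keys f \<Longrightarrow> b \<notin> S \<Longrightarrow> deg m \<le> deg b"
    using ex_has_least_nat[of "\<lambda>b. b \<in> Poly_Mapping.keys f \<and> b \<notin> S" k deg] by auto
  have "Poly_Mapping.lookup (u * f) (0 + m) = Poly_Mapping.lookup u 0 * Poly_Mapping.lookup f m"
  proof (rule lookup_mult_unique)
    fix a b assume ab: "a \<in> Poly_Mapping.keys u" "b \<in> Poly_Mapping.keys f" "a + b = 0 + m"
    then have "b \<notin> S" using S[of b a] m(2) by (auto simp: ac_simps)
    then have "deg m \<le> deg b" using ab least by blast
    moreover have "deg a + deg b = deg m" using ab(3) deg_add[of a b] by simp
    ultimately have "a = 0" by (intro deg_0) simp
    then show "a = 0 \<and> b = m" using ab by simp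
  qed
  then have "m \<in> Poly_Mapping.keys (u * f)" using u m by (simp add: in_keys_iff)
  then show False using uf m by (auto simp: monomial_ideal_def)
qed

lemma extend_contract_irrelevant:
  assumes S: "\<And>a b. a \<in> S \<Longrightarrow> a + b \<in> S"
  shows "extend_contract (poly_ring V :: ('v, 'k::field) mpoly ring) (monomial_ideal V (- {0}))
    (monomial_ideal V S) \<subseteq> monomial_ideal V S"
proof
  interpret M: primeideal "monomial_ideal V (- {0})" "poly_ring V :: ('v, 'k) mpoly ring"
    by (rule primeideal_irrelevant)
  fix f :: "('v, 'k) mpoly"
  assume f: "f \<in> extend_contract (poly_ring V) (monomial_ideal V (- {0})) (monomial_ideal V S)"
  then obtain u where u: "u \<in> carrier (poly_ring V) - monomial_ideal V (- {0})"
    "u \<otimes>\<^bsub>poly_ring V\<^esub> f \<in> monomial_ideal V S"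
    using M.mem_extend_contractD[OF ideal_monomial_ideal[OF S] f] by metis
  have "Poly_Mapping.lookup u 0 \<noteq> 0"
    using u(1) by (simp add: carrier_poly_ring mem_irrelevant_iff)
  moreover have "f \<in> monomial_ideal V UNIV"
    using f by (simp add: extend_contract_def carrier_poly_ring)
  ultimately show "f \<in> monomial_ideal V S"
    using mem_monomial_ideal_of_unit_mult[OF S] u(2) by auto
qed

lemma subset_extend_contract:
  assumes "primeideal P R" "J \<subseteq> carrier R"
  shows "J \<subseteq> extend_contract R P J"
proof
  interpret primeideal P R by fact
  fix f assume "f \<in> J"
  then show "f \<in> extend_contract R P J"
    using assms(2) one_in_complement by (intro mem_extend_contractI[of f "\<one>\<^bsub>R\<^esub>"]) auto
qed

section \<open>Naturally oriented unicyclic graphs\<close>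

text \<open>The vertices of a closed walk can be read off from its tails or from its heads. Both
  lists therefore have the same multiset, and distinctness of the heads passes to the tails.\<close>

lemma (in pair_wf_digraph) cycle_verts:
  assumes "cycle p"
  obtains u where "awalk u p u" "map fst p @ [u] = u # map snd p" "p \<noteq> []"
    "distinct (map fst p)" "distinct (map snd p)"
proof -
  from assms obtain u where u: "awalk u p u" "distinct (tl (awalk_verts u p))" "p \<noteq> []"
    by (auto simp: cycle_def)
  have "pawalk_verts u p = map fst p @ [snd (last p)]"
    using u(3) awalk_verts_conv[of u p] by simp
  moreover have snd: "pawalk_verts u p = fst (hd p) # map snd p"
    using u awalk_verts_conv'[of u p u] by (auto simp: awalk_def)
  moreover have "pawalk_verts u p = u # map snd p"
    using u snd by (cases p) (auto simp: awalk_simps)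
  moreover have "snd (last p) = u"
    using u awlast_of_awalk[OF u(1)] calculation(1) by simp
  ultimately have eq: "map fst p @ [u] = u # map snd p" by simp
  then have "mset (map fst p) = mset (map snd p)"
    by (metis add_mset_add_single mset.simps(2) mset_append add_mset_add_mset_same_iff
        append.simps(1) mset.simps(1))
  moreover have "distinct (map snd p)" using u(2) snd by simp
  ultimately have "distinct (map fst p)" using mset_eq_imp_distinct_iff by blast
  then show ?thesis using that u eq \<open>distinct (map snd p)\<close> by blast
qed

lemma mem_parcs_mk_symmetric_iff:
  "(x, y) \<in> parcs (mk_symmetric (with_proj D)) \<longleftrightarrow> (x, y) \<in> parcs D \<or> (y, x) \<in> parcs D"
  by (auto simp: parcs_mk_symmetric intro: bexI[of _ "(y, x)"])

lemma (in pair_digraph) pair_graph_mk_symmetric: "pair_graph (mk_symmetric (with_proj G))"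
proof -
  interpret M: pair_digraph "mk_symmetric (with_proj G)" by (rule digraph_mk_symmetric)
  show ?thesis by unfold_locales (rule symmetric_mk_symmetric)
qed

text \<open>\<open>C\<close> need not be the cycle that \<open>natural\<close> provides;
  unicyclicity gives both the same undirected edges, and \<open>dist_less\<close> carries the
  orientation over.\<close>

locale odd_unicyclic = weighted_oriented_graph D w
  for D :: "'v pair_pre_digraph" and w :: "'v \<Rightarrow> nat" +
  fixes C :: "('v \<times> 'v) list" and n :: nat
  assumes natural: "naturally_oriented_unicyclic D"
    and cycle_C: "cycle C" and length_C: "length C = 2 * n + 1"
begin

sublocale M: pair_graph "mk_symmetric (with_proj D)" by (rule pair_graph_mk_symmetric)

text \<open>The cycle vertices, written as the set from which
  \<open>naturally_oriented_unicyclic\<close> measures distances.\<close>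

definition S :: "'v set" where "S = fst ` set C"

abbreviation d :: "'v \<Rightarrow> nat" where "d \<equiv> graph_dist D S"

definition base :: 'v where "base = fst (hd C)"

lemma C_props: "awalk base C base" "map fst C @ [base] = base # map snd C" "C \<noteq> []"
    "distinct (map fst C)" "distinct (map snd C)"
proof -
  obtain u where u: "awalk u C u" "map fst C @ [u] = u # map snd C" "C \<noteq> []"
    "distinct (map fst C)" "distinct (map snd C)" using cycle_verts[OF cycle_C] .
  then have "u = base" unfolding base_def by (metis append.simps(1) hd_append2 hd_map list.sel(1) map_is_Nil_conv)
  with u show "awalk base C base" "map fst C @ [base] = base # map snd C" "C \<noteq> []"
    "distinct (map fst C)" "distinct (map snd C)" by auto
qed

lemma C_arcs: "set C \<subseteq> parcs D"
  using C_props(1) by (auto simp: awalk_def)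

lemma snd_C: "snd ` set C = S"
proof -
  have "mset (map fst C) = mset (map snd C)"
    using arg_cong[OF C_props(2), of mset] by simp
  then show ?thesis unfolding S_def by (metis set_map set_mset_mset)
qed

lemma base_in_S: "base \<in> S"
  using C_props(3) by (simp add: base_def S_def)

lemma C_in_S: "(x, y) \<in> set C \<Longrightarrow> x \<in> S" "(x, y) \<in> set C \<Longrightarrow> y \<in> S"
  using snd_C by (force simp: S_def)+

lemma S_verts: "S \<subseteq> pverts D"
  using C_arcs in_arcsD1 by (auto simp: S_def)

text \<open>A cycle of length 1 would be a loop. The odd length is thus at least 3, the bound in
  \<open>underlying_cycle\<close>.\<close>

lemma n_pos: "n \<ge> 1"
proof (rule ccontr)
  assume "\<not> n \<ge> 1"
  then have "length C = 1" using length_C by simp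
  then obtain e where "C = [e]" by (auto simp: length_Suc_conv)
  then have "fst e = snd e" "e \<in> parcs D" using C_props(2) C_arcs by auto
  then show False using pair_no_loops by blast
qed

lemma M_awalk: "awalk u p v \<Longrightarrow> M.awalk u p v"
  by (auto simp: awalk_def M.awalk_def mem_parcs_mk_symmetric_iff)

lemma underlying_cycle_C: "underlying_cycle D C"
proof -
  have "M.cycle C"
    unfolding M.cycle_def using M_awalk[OF C_props(1)] C_props snd_C
    by (intro exI[of _ base]) (simp add: awalk_verts_conv'[of base C base] awalk_def)
  then show ?thesis unfolding underlying_cycle_def using length_C n_pos by simp
qed

lemma underlying_cycle_edges:
  assumes "underlying_cycle D p"
  shows "(\<lambda>(x, y). {x, y}) ` set p = (\<lambda>(x, y). {x, y}) ` set C"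
  using natural assms underlying_cycle_C
  unfolding naturally_oriented_unicyclic_def unicyclic_def by metis

lemma connected_D: "Digraph_Component.connected D"
  using natural by (simp add: naturally_oriented_unicyclic_def unicyclic_def)

lemma dist_less:
  assumes "(x, y) \<in> parcs D" "(x, y) \<notin> set C"
  shows "d x < d y"
proof -
  obtain p where p: "underlying_cycle D p" "set p \<subseteq> parcs D"
    "\<forall>(x, y) \<in> parcs D - set p. graph_dist D (fst ` set p) x < graph_dist D (fst ` set p) y"
    using natural by (auto simp: naturally_oriented_unicyclic_def)
  \<comment> \<open>Equal sets of undirected edges give equal sets of arcs, because each edge
    carries only one orientation.\<close>
  have sub: "set q \<subseteq> set r"
    if "(\<lambda>(x, y). {x, y}) ` set q = (\<lambda>(x, y). {x, y}) ` set r" "set q \<subseteq> parcs D" "set r \<subseteq> parcs D" for q r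
  proof
    fix e assume e: "e \<in> set q"
    then have "(\<lambda>(x, y). {x, y}) e \<in> (\<lambda>(x, y). {x, y}) ` set r" using that(1) by blast
    then obtain a b where ab: "(a, b) \<in> set r" "{fst e, snd e} = {a, b}"
      by (auto simp: split_beta)
    then have "e = (a, b) \<or> e = (b, a)" by (cases e) (auto simp: doubleton_eq_iff)
    then show "e \<in> set r" using one_orientation[of a b] e ab(1) that(2,3) by blast
  qed
  have "set p = set C"
    using sub[OF underlying_cycle_edges[OF p(1)]] sub[OF underlying_cycle_edges[OF p(1), symmetric]]
      p(2) C_arcs by (intro equalityI)
  then show ?thesis using bspec[OF p(3), of "(x, y)"] assms by (simp add: S_def)
qed

lemma dist_0: "x \<in> S \<Longrightarrow> d x = 0"
  unfolding graph_dist_def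
  by (rule Least_eq_0) (use S_verts in \<open>auto intro!: bexI[of _ x] exI[of _ "[]"] simp: M.awalk_simps\<close>)

text \<open>An arc off the cycle ends strictly farther away than it starts, which is impossible at
  distance 0.\<close>

lemma arc_into_S: "(x, y) \<in> parcs D \<Longrightarrow> y \<in> S \<Longrightarrow> (x, y) \<in> set C"
  using dist_less dist_0 by fastforce

lemma arc_outside: "(x, y) \<in> parcs D \<Longrightarrow> y \<notin> S \<Longrightarrow> d x < d y"
  using dist_less C_in_S by blast

section \<open>Existence and uniqueness of in-neighbours\<close>

lemma ex_in_neighbour:
  assumes "x \<in> pverts D"
  shows "\<exists>z. (z, x) \<in> parcs D"
proof (cases "x \<in> S")
  case True
  then show ?thesis using snd_C C_arcs by force
next
  case False
  \<comment> \<open>A shortest walk from the cycle to \<open>x\<close> ends with an edge from a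
    nearer vertex.\<close>
  let ?P = "\<lambda>k. \<exists>c \<in> S. \<exists>q. M.awalk c q x \<and> length q = k"
  obtain q0 where "M.awalk base q0 x"
    using connected_awalkE[of base x] connected_D assms S_verts base_in_S by auto
  with base_in_S have "?P (length q0)" by blast
  then have "?P (d x)" unfolding graph_dist_def by (rule LeastI)
  then obtain c q where q: "c \<in> S" "M.awalk c q x" "length q = d x" by blast
  with False have "q \<noteq> []" by (auto simp: M.awalk_simps)
  then obtain q' e where e: "q = q' @ [e]" by (meson rev_exhaust)
  then have *: "M.awalk c q' (fst e)" "e \<in> parcs (mk_symmetric (with_proj D))" "snd e = x"
    using q(2) by (auto simp: M.awalk_append_iff M.awalk_simps)
  then have "d (fst e) \<le> length q'" unfolding graph_dist_def using q(1) by (intro Least_le) blast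
  then have less: "d (fst e) < d x" using e q by simp
  have "(fst e, x) \<in> parcs D \<or> (x, fst e) \<in> parcs D"
    using * mem_parcs_mk_symmetric_iff[of "fst e" x D] by auto
  \<comment> \<open>An arc from \<open>x\<close> to a nearer vertex would belong to the cycle, but
    \<open>x\<close> does not lie on it.\<close>
  moreover have "(x, fst e) \<notin> parcs D"
    using less dist_less[of x "fst e"] C_in_S(1)[of x "fst e"] False by force
  ultimately show ?thesis by blast
qed

text \<open>Off the cycle one steps back to an in-neighbour, which is strictly nearer; on the cycle
  an initial piece of \<open>C\<close> suffices. The bound keeps the walk away from vertices farther
  out than \<open>v\<close>, as \<open>in_neighbour_unique\<close> needs.\<close>

lemma base_walk:
  assumes "v \<in> pverts D"
  shows "\<exists>q. M.awalk base q v \<and> (\<forall>x \<in> set (pawalk_verts base q). d x \<le> d v)"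
  using assms
proof (induction "d v" arbitrary: v rule: less_induct)
  case less
  show ?case
  proof (cases "v \<in> S")
    case True
    have verts: "set (pawalk_verts base C) = S"
      using set_awalk_verts_not_Nil[OF C_props(1,3)] snd_C by (simp add: S_def)
    then obtain q r where qr: "C = q @ r" "M.awalk base q v"
      using M.awalk_decomp[OF M_awalk[OF C_props(1)], of v] True by blast
    then have "set (pawalk_verts base q) \<subseteq> S"
      using M.set_awalk_verts[OF qr(2)] snd_C base_in_S set_append[of q r]
      unfolding S_def by (auto simp flip: qr(1))
    then have "\<forall>x \<in> set (pawalk_verts base q). d x \<le> d v" using dist_0 by auto
    then show ?thesis using qr by blast
  next
    case False
    obtain z where z: "(z, v) \<in> parcs D" using ex_in_neighbour less.prems by blast
    then have lt: "d z < d v" using arc_outside False by blast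
    then obtain q where q: "M.awalk base q z" "\<forall>x \<in> set (pawalk_verts base q). d x \<le> d z"
      using less.hyps z in_arcsD1 by blast
    have zv: "M.awalk z [(z, v)] v"
      using z in_arcsD2 by (auto simp: M.awalk_simps mem_parcs_mk_symmetric_iff)
    have "M.awalk base (q @ [(z, v)]) v" by (rule M.awalk_appendI[OF q(1) zv])
    moreover have "\<forall>x \<in> set (pawalk_verts base (q @ [(z, v)])). d x \<le> d v"
      using M.set_awalk_verts_append[OF q(1) zv] q(2) lt by auto
    ultimately show ?thesis by blast
  qed
qed

text \<open>Two in-neighbours of a vertex off the cycle would close a second cycle through that vertex.\<close>

lemma in_neighbour_unique:
  assumes "(z, y) \<in> parcs D" "(z', y) \<in> parcs D"
  shows "z = z'"
proof (cases "y \<in> S")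
  case True
  then have "(z, y) \<in> set C" "(z', y) \<in> set C" using arc_into_S assms by auto
  then show ?thesis using C_props(5) by (metis distinct_map inj_on_def prod.inject snd_conv)
next
  case False
  show ?thesis
  proof (rule ccontr)
    assume neq: "z \<noteq> z'"
    obtain q q' where q: "M.awalk base q z" "\<forall>x \<in> set (pawalk_verts base q). d x \<le> d z"
      and q': "M.awalk base q' z'" "\<forall>x \<in> set (pawalk_verts base q'). d x \<le> d z'"
      using base_walk assms in_arcsD1 by meson
    have lt: "d z < d y" "d z' < d y" using arc_outside assms False by auto
    have rq: "M.awalk z (rev_path q) base" using q(1) by simp
    define W where "W = rev_path q @ q'"
    have W: "M.awalk z W z'" unfolding W_def by (rule M.awalk_appendI[OF rq q'(1)])
    have "set (pawalk_verts z W) = set (pawalk_verts base q) \<union> set (pawalk_verts base q')"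
      using M.set_awalk_verts_append[OF rq q'(1)] M.awalk_verts_rev_path[OF q(1)] by (simp add: W_def)
    \<comment> \<open>Both walks stay within distance \<open>d z\<close> or \<open>d z'\<close>, and
      both numbers are below \<open>d y\<close>.\<close>
    then have y_W: "y \<notin> set (pawalk_verts z W)" using q(2) q'(2) lt by fastforce
    define r where "r = M.awalk_to_apath W"
    have r: "M.apath z r z'" unfolding r_def by (rule M.apath_awalk_to_apath[OF W])
    have "set (pawalk_verts z r) \<subseteq> set (pawalk_verts z W)"
      using M.set_awalk_verts[OF W] M.set_awalk_verts[OF M.awalkI_apath[OF r]]
        M.awalk_to_apath_subset[OF W] unfolding r_def by auto
    then have y_r: "y \<notin> set (pawalk_verts z r)" using y_W by blast
    \<comment> \<open>This gives \<open>c\<close> at least three edges, as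
      \<open>underlying_cycle\<close> requires.\<close>
    have "r \<noteq> []" using r neq by (auto simp: M.apath_simps)
    define c where "c = (y, z) # r @ [(z', y)]"
    have rw: "M.awalk z r z'" "distinct (pawalk_verts z r)" using r by (auto simp: M.apath_def)
    have e: "M.awalk z' [(z', y)] y"
      using assms in_arcsD2 by (auto simp: M.awalk_simps mem_parcs_mk_symmetric_iff)
    have ry: "M.awalk z (r @ [(z', y)]) y" by (rule M.awalk_appendI[OF rw(1) e])
    then have "M.awalk y c y"
      using assms by (auto simp: c_def M.awalk_Cons_iff mem_parcs_mk_symmetric_iff)
    moreover have "pawalk_verts z (r @ [(z', y)]) = pawalk_verts z r @ [y]"
      using M.awalk_verts_append[OF ry] by simp
    then have "distinct (tl (pawalk_verts y c))"
      using rw(2) y_r by (simp add: c_def)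
    ultimately have "underlying_cycle D c"
      using \<open>r \<noteq> []\<close> unfolding underlying_cycle_def M.cycle_def
      by (auto simp: c_def Suc_le_eq)
    then have "(\<lambda>(x, y). {x, y}) ` set c = (\<lambda>(x, y). {x, y}) ` set C" by (rule underlying_cycle_edges)
    then have "{y, z} \<in> (\<lambda>(x, y). {x, y}) ` set C" by (auto simp: c_def)
    then have "y \<in> S" using C_in_S by (auto simp: doubleton_eq_iff)
    then show False using False by simp
  qed
qed

end

declare power_expos.simps(2) [simp del]

section \<open>Edge ideals\<close>

definition edge_expos :: "'v pair_pre_digraph \<Rightarrow> ('v \<Rightarrow> nat) \<Rightarrow> ('v \<Rightarrow>\<^sub>0 nat) set" where
  "edge_expos D w = {Poly_Mapping.single x 1 + Poly_Mapping.single y (w y) | x y. (x, y) \<in> parcs D}"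

lemma var_power: "var x ^ k = Poly_Mapping.single (Poly_Mapping.single x k) 1"
proof (induction k)
  case (Suc k)
  have "Poly_Mapping.single x (Suc k) = Poly_Mapping.single x 1 + Poly_Mapping.single x k"
    by (simp flip: single_add)
  then show ?case using Suc by (simp add: var_def mult_single)
qed simp

text \<open>Divisibility of monomials is pointwise comparison, and truncated subtraction is exact
  there.\<close>

lemma mem_power_expos_le:
  assumes "m \<in> power_expos G s" "\<And>x. Poly_Mapping.lookup m x \<le> Poly_Mapping.lookup f x"
  shows "f \<in> power_expos G s"
proof -
  have "f = m + (f - m)"
    using assms(2) by (intro poly_mapping_eqI) (simp add: lookup_add lookup_minus)
  then show ?thesis using power_expos_up[OF assms(1), of "f - m"] by simp
qed

context weighted_oriented_graph
begin

abbreviation U :: "nat \<Rightarrow> ('v \<Rightarrow>\<^sub>0 nat) set" where "U \<equiv> power_expos (edge_expos D w)"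

lemma keys_edge_expos: "g \<in> edge_expos D w \<Longrightarrow> Poly_Mapping.keys g \<subseteq> pverts D"
  using in_arcsD1 in_arcsD2 by (auto simp: edge_expos_def keys_add_nat split: if_splits)

lemma edge_ideal_eq: "edge_ideal D w = (monomial_ideal (pverts D) (U 1) :: ('v, 'k::field) mpoly set)"
proof -
  have "var x * var y ^ k = Poly_Mapping.single (Poly_Mapping.single x 1 + Poly_Mapping.single y k) (1::'k)"
    for x y :: 'v and k
    unfolding var_power by (simp add: var_def mult_single)
  then have "{var x * var y ^ w y | x y. (x, y) \<in> parcs D} =
      ((\<lambda>g. Poly_Mapping.single g 1) ` edge_expos D w :: ('v, 'k) mpoly set)"
    unfolding edge_expos_def by auto
  then show ?thesis
    unfolding edge_ideal_def using genideal_monomials[OF keys_edge_expos] by simp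
qed

lemma edge_ideal_power:
  "(edge_ideal D w :: ('v, 'k::field) mpoly set) [^]\<^bsub>ideals_set (poly_ring (pverts D))\<^esub> s =
    monomial_ideal (pverts D) (U s)"
  unfolding edge_ideal_eq using monomial_ideal_power[OF keys_edge_expos] .

lemma edge_mem_U_1:
  "(x, y) \<in> parcs D \<Longrightarrow> Poly_Mapping.single x 1 + Poly_Mapping.single y (w y) \<in> U 1"
  by (intro mem_power_expos_1) (auto simp: edge_expos_def)

lemma U_Suc_cases:
  assumes "m \<in> U (Suc s)"
  obtains x y m' where "(x, y) \<in> parcs D" "m' \<in> U s"
    "m = Poly_Mapping.single x 1 + Poly_Mapping.single y (w y) + m'"
  using assms by (auto simp: edge_expos_def power_expos.simps)

text \<open>An edge monomial that divides the product but not \<open>k\<close> must need the raised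
  exponent at \<open>q\<close> exactly, so \<open>q\<close> is one of its ends; the other end
  already has its full exponent in \<open>k\<close>.\<close>

lemma mult_var_mem_U_1_cases [consumes 2, case_names tail head]:
  assumes "k \<notin> U 1" "Poly_Mapping.single q 1 + k \<in> U 1"
  obtains y where "(q, y) \<in> parcs D" "Poly_Mapping.lookup k q = 0" "w y \<le> Poly_Mapping.lookup k y"
  | x where "(x, q) \<in> parcs D" "w q = Poly_Mapping.lookup k q + 1" "1 \<le> Poly_Mapping.lookup k x"
proof -
  obtain x y m where xy: "(x, y) \<in> parcs D"
    and eq: "Poly_Mapping.single q 1 + k = Poly_Mapping.single x 1 + Poly_Mapping.single y (w y) + m"
    using assms(2) by (metis One_nat_def U_Suc_cases)
  define e where "e = Poly_Mapping.single x 1 + Poly_Mapping.single y (w y)"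
  have "x \<noteq> y" using xy no_loops' by blast
  then have e: "Poly_Mapping.lookup e x = 1" "Poly_Mapping.lookup e y = w y"
    "\<And>z. z \<noteq> x \<Longrightarrow> z \<noteq> y \<Longrightarrow> Poly_Mapping.lookup e z = 0"
    by (auto simp: e_def lookup_add lookup_single when_def)
  have le: "Poly_Mapping.lookup e z \<le> (if z = q then 1 else 0) + Poly_Mapping.lookup k z" for z
    using arg_cong[OF eq, of "\<lambda>m. Poly_Mapping.lookup m z"]
    by (auto simp: e_def lookup_add lookup_single when_def split: if_splits)
  have "\<not> (\<forall>z. Poly_Mapping.lookup e z \<le> Poly_Mapping.lookup k z)"
    using assms(1) mem_power_expos_le[OF edge_mem_U_1[OF xy]] unfolding e_def by blast
  then obtain z where "\<not> Poly_Mapping.lookup e z \<le> Poly_Mapping.lookup k z" by blast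
  then have q: "Poly_Mapping.lookup e q = Poly_Mapping.lookup k q + 1"
    using le[of z] by (auto split: if_splits)
  then consider "q = x" | "q = y" using e(3)[of q] by fastforce
  then show ?thesis
  proof cases
    case 1
    then show ?thesis using that(1)[of y] xy q e le[of y] \<open>x \<noteq> y\<close> by simp
  next
    case 2
    then show ?thesis using that(2)[of x] xy q e le[of x] \<open>x \<noteq> y\<close> by simp
  qed
qed

text \<open>An in-neighbour and an out-neighbour differ, since an edge carries one
  orientation.\<close>

lemma degree_ge_2:
  assumes "(a, x) \<in> parcs D" "(x, b) \<in> parcs D"
  shows "graph_degree D x \<ge> 2"
proof -
  have "{y. (x, y) \<in> parcs (mk_symmetric (with_proj D))} \<subseteq> pverts D"
    using in_arcsD1 in_arcsD2 by (auto simp: mem_parcs_mk_symmetric_iff)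
  then have "finite {y. (x, y) \<in> parcs (mk_symmetric (with_proj D))}"
    using pair_finite_verts finite_subset by blast
  moreover have "{a, b} \<subseteq> {y. (x, y) \<in> parcs (mk_symmetric (with_proj D))}"
    using assms by (auto simp: mem_parcs_mk_symmetric_iff)
  ultimately have "card {a, b} \<le> graph_degree D x"
    unfolding graph_degree_def by (rule card_mono)
  moreover have "a \<noteq> b" using assms one_orientation by blast
  ultimately show ?thesis by simp
qed

text \<open>The witness is the monomial in which every vertex \<open>x\<close> has exponent \<open>w x - 1\<close>.\<close>

lemma irrelevant_mem_assoc_primes:
  assumes "\<And>x. x \<in> pverts D \<Longrightarrow> \<exists>z. (z, x) \<in> parcs D \<and> w z \<ge> 2"
  shows "monomial_ideal (pverts D) (- {0}) \<in>
    assoc_primes (poly_ring (pverts D)) (edge_ideal D w :: ('v, 'k::field) mpoly set)"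
proof -
  let ?V = "pverts D"
  define R where "R = (poly_ring ?V :: ('v, 'k) mpoly ring)"
  define I where "I = (monomial_ideal ?V (U 1) :: ('v, 'k) mpoly set)"
  interpret I: ideal I R unfolding I_def R_def by (rule ideal_power_expos)
  define F where "F = (\<Sum>x\<in>?V. Poly_Mapping.single x (w x - 1))"
  have lookup_F: "Poly_Mapping.lookup F x = (if x \<in> ?V then w x - 1 else 0)" for x
    using pair_finite_verts
    by (auto simp: F_def lookup_sum lookup_single when_def)
  have keys_F: "Poly_Mapping.keys F \<subseteq> ?V"
    by (auto simp: in_keys_iff lookup_F split: if_splits)
  have F_notin: "F \<notin> U 1"
  proof
    assume "F \<in> U 1"
    then obtain x y m where xy: "(x, y) \<in> parcs D"
      and F: "F = Poly_Mapping.single x 1 + Poly_Mapping.single y (w y) + m"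
      by (metis One_nat_def U_Suc_cases)
    \<comment> \<open>An edge monomial has exponent \<open>w y\<close> at its head, one more than
      \<open>F\<close> offers.\<close>
    have "w y \<le> Poly_Mapping.lookup F y" by (simp add: F lookup_add)
    then show False using xy in_arcsD2[OF xy] weight_pos[of y] by (simp add: lookup_F)
  qed
  have F_mult: "a + F \<in> U 1" if a: "a \<noteq> 0" "Poly_Mapping.keys a \<subseteq> ?V" for a
  proof -
    obtain x where x: "x \<in> Poly_Mapping.keys a" using a(1) by (metis ex_in_conv keys_eq_empty)
    then obtain z where z: "(z, x) \<in> parcs D" "w z \<ge> 2" using assms a(2) by blast
    \<comment> \<open>The edge from \<open>z\<close> to \<open>x\<close> works: \<open>a\<close>
      raises the exponent of \<open>x\<close> to at least \<open>w x\<close>, and that of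
      \<open>z\<close> is at least \<open>w z - 1\<close>, hence positive.\<close>
    have "Poly_Mapping.lookup (Poly_Mapping.single z 1 + Poly_Mapping.single x (w x)) t
        \<le> Poly_Mapping.lookup (a + F) t" for t
      using z x in_arcsD1[OF z(1)] in_arcsD2[OF z(1)] no_loops'[OF z(1)]
      by (auto simp: lookup_add lookup_single when_def lookup_F in_keys_iff)
    then show ?thesis by (rule mem_power_expos_le[OF edge_mem_U_1[OF z(1)]])
  qed
  define g where "g = (Poly_Mapping.single F 1 :: ('v, 'k) mpoly)"
  have g: "g \<in> carrier R"
    using keys_F by (simp add: g_def R_def carrier_poly_ring monomial_mem_monomial_ideal)
  have "monomial_ideal ?V (- {0}) = quot_annihilator R I (I +>\<^bsub>R\<^esub> g)"
  proof (intro equalityI subsetI)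
    fix r :: "('v, 'k) mpoly" assume r: "r \<in> monomial_ideal ?V (- {0})"
    have "r * g \<in> I"
      unfolding I_def monomial_ideal_def
    proof (intro CollectI ballI)
      fix m assume "m \<in> Poly_Mapping.keys (r * g)"
      then obtain a where a: "a \<in> Poly_Mapping.keys r" "m = a + F"
        by (auto simp: g_def elim!: keys_mult_cases)
      then show "Poly_Mapping.keys m \<subseteq> ?V \<and> m \<in> U 1"
        using r F_mult[of a] keys_F by (auto simp: monomial_ideal_def keys_add_nat)
    qed
    then show "r \<in> quot_annihilator R I (I +>\<^bsub>R\<^esub> g)"
      using r unfolding I.mem_quot_annihilator_iff[OF g]
      by (simp add: R_def carrier_poly_ring mem_irrelevant_iff)
  next
    fix r assume "r \<in> quot_annihilator R I (I +>\<^bsub>R\<^esub> g)"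
    then have r: "r \<in> monomial_ideal ?V UNIV" "g * r \<in> I"
      unfolding I.mem_quot_annihilator_iff[OF g] by (auto simp: R_def carrier_poly_ring mult.commute)
    \<comment> \<open>A constant term of \<open>r\<close> would give \<open>g * r\<close> the
      exponent \<open>F\<close>, which lies outside \<open>U 1\<close>.\<close>
    have "0 \<notin> Poly_Mapping.keys r"
      using mem_monomial_ideal_monomial_mult[of F r ?V "U 1" 0] r(2) F_notin
      by (auto simp: g_def I_def)
    then show "r \<in> monomial_ideal ?V (- {0})"
      using r(1) by (simp add: mem_irrelevant_iff in_keys_iff)
  qed
  moreover have "I +>\<^bsub>R\<^esub> g \<in> carrier (R Quot I)"
    using g I.a_rcosetsI[OF I.a_subset] by (simp add: FactRing_def)
  ultimately show ?thesis
    using primeideal_irrelevant[of ?V] unfolding assoc_primes_def edge_ideal_eq R_def I_def by blast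
qed

text \<open>The contraction at the irrelevant ideal lies in the ordinary power, while the
  contraction at every associated prime contains that power.\<close>

lemma symbolic_power_eq:
  assumes "\<And>x. x \<in> pverts D \<Longrightarrow> \<exists>z. (z, x) \<in> parcs D \<and> w z \<ge> 2"
  shows "symbolic_power (poly_ring (pverts D)) (edge_ideal D w :: ('v, 'k::field) mpoly set) s
    = edge_ideal D w [^]\<^bsub>ideals_set (poly_ring (pverts D))\<^esub> s"
proof
  let ?R = "poly_ring (pverts D) :: ('v, 'k) mpoly ring"
  show "symbolic_power ?R (edge_ideal D w) s \<subseteq> edge_ideal D w [^]\<^bsub>ideals_set ?R\<^esub> s"
    using irrelevant_mem_assoc_primes[OF assms]
      extend_contract_irrelevant[of "U s" "pverts D", OF power_expos_up]
    unfolding symbolic_power_def edge_ideal_power by blast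
  have "monomial_ideal (pverts D) (U s) \<subseteq> carrier ?R"
    unfolding carrier_poly_ring by (rule monomial_ideal_mono) simp
  then show "edge_ideal D w [^]\<^bsub>ideals_set ?R\<^esub> s \<subseteq> symbolic_power ?R (edge_ideal D w) s"
    using subset_extend_contract[of _ ?R "monomial_ideal (pverts D) (U s)"]
    unfolding symbolic_power_def edge_ideal_power assoc_primes_def by blast
qed

end

section \<open>A criterion for symbolic and ordinary powers to differ\<close>

context odd_unicyclic
begin

text \<open>Let \<open>k\<close> be a monomial outside the edge ideal. If \<open>v * k\<close> lies in the ideal, then some edge
  monomial through \<open>v\<close> divides it, so the other end of that edge already has its maximal exponent
  in \<open>k\<close> and cannot multiply \<open>k\<close> into the ideal.\<close>

lemma assoc_prime_avoids:
  assumes "P \<in> assoc_primes (poly_ring (pverts D)) (edge_ideal D w :: ('v, 'k::field) mpoly set)"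
    and pv: "(p, v) \<in> parcs D" and wp: "w p = 1"
  obtains q where "q = p \<or> q = v \<or> (v, q) \<in> parcs D" "var q \<notin> P"
proof -
  let ?V = "pverts D"
  define R where "R = (poly_ring ?V :: ('v, 'k) mpoly ring)"
  define I where "I = (monomial_ideal ?V (U 1) :: ('v, 'k) mpoly set)"
  interpret I: ideal I R unfolding I_def R_def by (rule ideal_power_expos)
  from assms(1) obtain m where P: "primeideal P R" "m \<in> carrier (R Quot I)" "P = quot_annihilator R I m"
    unfolding assoc_primes_def edge_ideal_eq R_def I_def by blast
  then obtain g where g: "g \<in> carrier R" "P = quot_annihilator R I (I +>\<^bsub>R\<^esub> g)"
    using I.quot_carrier_cases by metis
  note P_iff = I.mem_quot_annihilator_iff[OF g(1), folded g(2)]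
  have "\<one>\<^bsub>R\<^esub> \<notin> P" using primeideal.one_in_complement[OF P(1)] by blast
  then have "g \<notin> I" using g(1) by (auto simp: P_iff)
  then obtain k where k: "k \<in> Poly_Mapping.keys g" "k \<notin> U 1"
    using g(1) by (auto simp: R_def carrier_poly_ring I_def monomial_ideal_def simp del: power_expos.simps)
  have "\<exists>q. (q = p \<or> q = v \<or> (v, q) \<in> parcs D) \<and> var q \<notin> P"
  proof (rule ccontr)
    assume "\<not> ?thesis"
    then have "var q * g \<in> I" if "q = p \<or> q = v \<or> (v, q) \<in> parcs D" for q
      using that by (auto simp: P_iff R_def)
    then have mult: "Poly_Mapping.single q 1 + k \<in> U 1" if "q = p \<or> q = v \<or> (v, q) \<in> parcs D" for q
      using that mem_monomial_ideal_monomial_mult[OF _ k(1)] unfolding I_def var_def by blast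
    have "Poly_Mapping.single v 1 + k \<in> U 1" using mult by blast
    with k(2) show False
    proof (cases rule: mult_var_mem_U_1_cases)
      case (tail y)
      \<comment> \<open>Raising the exponent of \<open>y\<close> cannot help: a tail would need
        exponent 0 in \<open>k\<close> and a head \<open>w y - 1\<close>, but \<open>y\<close> has
        at least \<open>w y\<close>, which is positive.\<close>
      then have "Poly_Mapping.single y 1 + k \<in> U 1" using mult by blast
      with k(2) show False
        using tail weight_pos[OF in_arcsD2[OF tail(1)]] by (cases rule: mult_var_mem_U_1_cases) auto
    next
      case (head x)
      then have "x = p" using in_neighbour_unique pv by blast
      \<comment> \<open>As \<open>p\<close> occurs in \<open>k\<close>, it cannot be the tail; as
        the head it would need exponent \<open>w p - 1\<close>, which is 0 because \<open>p\<close>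
        has weight one.\<close>
      have "Poly_Mapping.single p 1 + k \<in> U 1" using mult by blast
      with k(2) show False
        using head \<open>x = p\<close> wp by (cases rule: mult_var_mem_U_1_cases) auto
    qed
  qed
  then show ?thesis using that by blast
qed

text \<open>Each associated prime misses one of the variables covered by \<open>mult\<close>. By
  primality all powers of that variable stay outside the prime and serve as multipliers in
  \<open>mem_extend_contractI\<close>.\<close>

lemma symbolic_power_neq:
  assumes pv: "(p, v) \<in> parcs D" "w p = 1" and f: "Poly_Mapping.keys f \<subseteq> pverts D" "f \<notin> U s"
    and mult: "\<And>q. q = p \<or> q = v \<or> (v, q) \<in> parcs D \<Longrightarrow> \<exists>k. Poly_Mapping.single q k + f \<in> U s"
  shows "symbolic_power (poly_ring (pverts D)) (edge_ideal D w :: ('v, 'k::field) mpoly set) s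
    \<noteq> edge_ideal D w [^]\<^bsub>ideals_set (poly_ring (pverts D))\<^esub> s"
proof -
  let ?R = "poly_ring (pverts D) :: ('v, 'k) mpoly ring"
  let ?f = "Poly_Mapping.single f 1 :: ('v, 'k) mpoly"
  have carr: "?f \<in> carrier ?R" using f(1) by (simp add: carrier_poly_ring monomial_mem_monomial_ideal)
  have "?f \<in> extend_contract ?R P (monomial_ideal (pverts D) (U s))"
    if P: "P \<in> assoc_primes ?R (edge_ideal D w)" for P
  proof -
    interpret P: primeideal P ?R using P by (simp add: assoc_primes_def)
    obtain q where q: "q = p \<or> q = v \<or> (v, q) \<in> parcs D" "var q \<notin> P"
      using assoc_prime_avoids[OF P pv] .
    obtain k where k: "Poly_Mapping.single q k + f \<in> U s" using mult q(1) by blast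
    have qV: "q \<in> pverts D" using q(1) pv(1) in_arcsD1 in_arcsD2 by blast
    have "var q \<in> carrier ?R - P"
      using q(2) qV by (simp add: var_def carrier_poly_ring monomial_mem_monomial_ideal)
    then have "var q ^ k \<in> carrier ?R - P"
    proof (induction k)
      case 0
      then show ?case using P.one_in_complement by simp
    next
      case (Suc k)
      then show ?case using P.mult_in_complement[of "var q" "var q ^ k"] by simp
    qed
    moreover have "var q ^ k * ?f \<in> monomial_ideal (pverts D) (U s)"
      using k f(1) qV by (simp add: var_power mult_single monomial_mem_monomial_ideal keys_add_nat)
    moreover have "monomial_ideal (pverts D) (U s) \<subseteq> carrier ?R"
      unfolding carrier_poly_ring by (rule monomial_ideal_mono) simp
    ultimately show ?thesis
      using carr by (intro P.mem_extend_contractI[of _ "var q ^ k"]) simp_all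
  qed
  then have "?f \<in> symbolic_power ?R (edge_ideal D w) s"
    using carr unfolding symbolic_power_def edge_ideal_power by blast
  moreover have "?f \<notin> monomial_ideal (pverts D) (U s)"
    using f(2) by (simp add: monomial_mem_monomial_ideal)
  ultimately show ?thesis unfolding edge_ideal_power by metis
qed

section \<open>A vertex of weight one on the cycle\<close>

text \<open>Reading the index modulo the length lets a walk around the cycle run past the end of the
  list \<open>C\<close>.\<close>

definition cyc :: "nat \<Rightarrow> 'v" where "cyc i = fst (C ! (i mod (2 * n + 1)))"

lemma cyc_arc: "(cyc i, cyc (Suc i)) \<in> set C"
proof -
  let ?N = "2 * n + 1"
  define j where "j = i mod ?N"
  have j: "j < length C" by (simp add: j_def length_C)
  have "snd (C ! j) = (map fst C @ [base]) ! Suc j"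
    using j by (simp add: C_props(2))
  \<comment> \<open>The last arc returns to \<open>base\<close>, where the index wraps around to
    0.\<close>
  also have "\<dots> = cyc (Suc i)"
  proof (cases "Suc j = ?N")
    case True
    then have "Suc i mod ?N = 0" by (simp add: j_def mod_Suc)
    then show ?thesis using True C_props(3) length_C
      by (simp add: cyc_def nth_append base_def hd_conv_nth)
  next
    case False
    then have "Suc i mod ?N = Suc j" by (simp add: j_def mod_Suc)
    then show ?thesis using False j length_C by (simp add: cyc_def nth_append)
  qed
  finally have "C ! j = (cyc i, cyc (Suc i))"
    by (simp add: cyc_def j_def prod_eq_iff)
  then show ?thesis using nth_mem[OF j] by simp
qed

lemma card_S: "card S = 2 * n + 1"
  using C_props(4) length_C unfolding S_def by (metis distinct_card length_map set_map)

lemma finite_S: "finite S"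
  by (simp add: S_def)

text \<open>The free offset \<open>i\<close> allows a sum over the cycle to be listed from any
  chosen vertex.\<close>

lemma bij_cyc: "bij_betw (\<lambda>k. cyc (i + k)) {..<2 * n + 1} S"
proof -
  let ?N = "2 * n + 1"
  have eq: "k = l" if "(i + k) mod ?N = (i + l) mod ?N" "k \<le> l" "l < ?N" for k l
  proof -
    have "?N dvd (i + l) - (i + k)"
      using that(1,2) mod_eq_dvd_iff_nat[of "i + k" "i + l" ?N] by simp
    then show ?thesis using that(2,3) by (auto dest: dvd_imp_le)
  qed
  have inj: "inj_on (\<lambda>k. cyc (i + k)) {..<?N}"
  proof (rule inj_onI)
    fix k l assume kl: "k \<in> {..<?N}" "l \<in> {..<?N}" "cyc (i + k) = cyc (i + l)"
    then have "(i + k) mod ?N = (i + l) mod ?N"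
      using nth_eq_iff_index_eq[OF C_props(4), of "(i + k) mod ?N" "(i + l) mod ?N"] length_C
      by (simp add: cyc_def)
    then show "k = l" using eq[of k l] eq[of l k] kl(1,2) by (metis lessThan_iff nle_le)
  qed
  moreover have "(\<lambda>k. cyc (i + k)) ` {..<?N} = S"
  proof (rule card_subset_eq[OF finite_S])
    show "(\<lambda>k. cyc (i + k)) ` {..<?N} \<subseteq> S" using cyc_arc C_in_S by blast
    show "card ((\<lambda>k. cyc (i + k)) ` {..<?N}) = card S" using card_image[OF inj] card_S by simp
  qed
  ultimately show ?thesis by (simp add: bij_betw_def)
qed

definition cycle_expo :: "'v \<Rightarrow>\<^sub>0 nat" where
  "cycle_expo = (\<Sum>x\<in>S. Poly_Mapping.single x (w x))"

lemma lookup_cycle_expo: "Poly_Mapping.lookup cycle_expo x = (if x \<in> S then w x else 0)"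
  using finite_S by (auto simp: cycle_expo_def lookup_sum lookup_single when_def)

lemma single_weight_split:
  "x \<in> pverts D \<Longrightarrow> Poly_Mapping.single x (w x) = Poly_Mapping.single x 1 + Poly_Mapping.single x (w x - 1)"
  using weight_pos[of x] by (simp flip: single_add)

lemma weighted_edge_mem_U_1:
  assumes "(x, y) \<in> parcs D"
  shows "Poly_Mapping.single x (w x) + Poly_Mapping.single y (w y) \<in> U 1"
proof -
  have "Poly_Mapping.single x (w x) + Poly_Mapping.single y (w y) =
      Poly_Mapping.single x 1 + Poly_Mapping.single y (w y) + Poly_Mapping.single x (w x - 1)"
    using single_weight_split[OF in_arcsD1[OF assms]] by (simp add: ac_simps)
  then show ?thesis using power_expos_up[OF edge_mem_U_1[OF assms]] by metis
qed

text \<open>Removing one vertex from the odd cycle leaves a path with a perfect matching of \<open>n\<close> edges.\<close>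

lemma cycle_expo_mult_mem:
  assumes ab: "(a, b) \<in> parcs D" "a \<in> S"
  shows "Poly_Mapping.single b (w b) + cycle_expo \<in> U (n + 1)"
proof -
  obtain i where a: "a = cyc i"
    using bij_betw_imp_surj_on[OF bij_cyc[of 0]] ab(2) by auto
  define h where "h k = Poly_Mapping.single (cyc (i + k)) (w (cyc (i + k)))" for k
  have "cycle_expo = (\<Sum>k<2 * n + 1. h k)"
    unfolding cycle_expo_def h_def
    using sum.reindex_bij_betw[OF bij_cyc[of i], of "\<lambda>x. Poly_Mapping.single x (w x)"] by simp
  \<comment> \<open>The first vertex is set aside and the remaining \<open>2 * n\<close> are grouped
    into consecutive pairs, which are edges.\<close>
  also have "\<dots> = h 0 + (\<Sum>k<n. h (2 * k + 1) + h (2 * k + 2))"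
    by (induction n) (simp_all add: ac_simps)
  finally have eq: "cycle_expo = h 0 + (\<Sum>k<n. h (2 * k + 1) + h (2 * k + 2))" .
  have "(\<Sum>k<m. h (2 * k + 1) + h (2 * k + 2)) \<in> U m" for m
  proof (induction m)
    case (Suc m)
    have "(cyc (i + (2 * m + 1)), cyc (i + (2 * m + 2))) \<in> parcs D"
      using cyc_arc[of "i + (2 * m + 1)"] C_arcs by auto
    then have "h (2 * m + 1) + h (2 * m + 2) \<in> U 1"
      unfolding h_def by (rule weighted_edge_mem_U_1)
    from power_expos_add[OF Suc this] show ?case by simp
  qed simp
  \<comment> \<open>The vertex set aside is \<open>a\<close>; the additional factor at
    \<open>b\<close> completes it to one more edge.\<close>
  moreover have "Poly_Mapping.single b (w b) + h 0 \<in> U 1"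
    using weighted_edge_mem_U_1[OF ab(1)] by (simp add: h_def a add.commute)
  ultimately have "(\<Sum>k<n. h (2 * k + 1) + h (2 * k + 2)) + (Poly_Mapping.single b (w b) + h 0) \<in> U (n + 1)"
    by (intro power_expos_add)
  then show ?thesis by (simp only: eq ac_simps)
qed

text \<open>The set \<open>H\<close> collects the heads of the edges used. A head exhausts its variable, so it is
  not the tail of another edge used.\<close>

lemma heads_of_cycle_edges:
  assumes "m \<in> U s" "\<And>x. Poly_Mapping.lookup m x \<le> (if x \<in> S then w x else 0)"
  shows "\<exists>H \<subseteq> S. card H = s \<and> (\<forall>b \<in> H. w b \<le> Poly_Mapping.lookup m b \<and>
    (\<forall>a. (a, b) \<in> parcs D \<longrightarrow> a \<in> S - H \<and> 1 \<le> Poly_Mapping.lookup m a))"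
  using assms
proof (induction s arbitrary: m)
  case 0
  then show ?case by (intro exI[of _ "{}"]) simp
next
  case (Suc s)
  obtain a b m' where ab: "(a, b) \<in> parcs D" and m': "m' \<in> U s"
    and m: "m = Poly_Mapping.single a 1 + Poly_Mapping.single b (w b) + m'"
    using Suc.prems(1) by (rule U_Suc_cases)
  have "a \<noteq> b" using ab no_loops' by blast
  then have lookups: "Poly_Mapping.lookup m a = 1 + Poly_Mapping.lookup m' a"
    "Poly_Mapping.lookup m b = w b + Poly_Mapping.lookup m' b"
    "\<And>x. Poly_Mapping.lookup m' x \<le> Poly_Mapping.lookup m x"
    by (auto simp: m lookup_add lookup_single when_def)
  have wb: "w b \<ge> 1" using weight_pos in_arcsD2 ab by blast
  \<comment> \<open>The bound \<open>w b\<close> on the exponent of \<open>b\<close> is used up by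
    this edge, so none is left in \<open>m'\<close>; at \<open>a\<close> the exponent left in
    \<open>m'\<close> stays below \<open>w a\<close>.\<close>
  have S: "a \<in> S" "b \<in> S" "1 + Poly_Mapping.lookup m' a \<le> w a" "Poly_Mapping.lookup m' b = 0"
    using Suc.prems(2)[of a] Suc.prems(2)[of b] lookups wb by (auto split: if_splits)
  have "\<And>x. Poly_Mapping.lookup m' x \<le> (if x \<in> S then w x else 0)"
    using Suc.prems(2) lookups(3) le_trans by blast
  then obtain H where H: "H \<subseteq> S" "card H = s" "\<And>b. b \<in> H \<Longrightarrow> w b \<le> Poly_Mapping.lookup m' b"
    "\<And>a b. b \<in> H \<Longrightarrow> (a, b) \<in> parcs D \<Longrightarrow> a \<in> S - H \<and> 1 \<le> Poly_Mapping.lookup m' a"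
    using Suc.IH[OF m'] by blast
  \<comment> \<open>A head in \<open>H\<close> would still have its full weight as exponent in
    \<open>m'\<close>, which neither \<open>a\<close> nor \<open>b\<close> has.\<close>
  have notin: "a \<notin> H" "b \<notin> H" using H(3)[of a] H(3)[of b] S wb by auto
  have fin: "finite H" using H(1) finite_S finite_subset by blast
  show ?case
  proof (intro exI[of _ "insert b H"] conjI ballI allI impI)
    show "card (insert b H) = Suc s" using fin notin H(2) by simp
    fix h assume h: "h \<in> insert b H"
    show "w h \<le> Poly_Mapping.lookup m h" using h H(3)[of h] lookups(2) lookups(3)[of h] by auto
    fix a' assume a': "(a', h) \<in> parcs D"
    show "a' \<in> S - insert b H" "1 \<le> Poly_Mapping.lookup m a'"
    proof -
      have "a' \<in> S - insert b H \<and> 1 \<le> Poly_Mapping.lookup m a'"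
      proof (cases "h = b")
        case True
        then have "a' = a" using a' ab in_neighbour_unique by blast
        then show ?thesis using S notin lookups(1) \<open>a \<noteq> b\<close> by simp
      next
        case False
        then have "a' \<in> S - H" "1 \<le> Poly_Mapping.lookup m' a'" using H(4) h a' by auto
        \<comment> \<open>\<open>a'\<close> differs from \<open>b\<close> because it occurs in
          \<open>m'\<close> and \<open>b\<close> does not.\<close>
        then show ?thesis using S(4) lookups(3)[of a'] by auto
      qed
      then show "a' \<in> S - insert b H" "1 \<le> Poly_Mapping.lookup m a'" by auto
    qed
  qed (use H(1) S in auto)
qed

text \<open>The \<open>n + 1\<close> heads have distinct predecessors on the cycle, all outside
  \<open>H\<close>, but only \<open>n\<close> cycle vertices lie outside \<open>H\<close>.\<close>

lemma cycle_expo_notin: "cycle_expo \<notin> U (n + 1)"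
proof
  assume "cycle_expo \<in> U (n + 1)"
  then obtain H where H: "H \<subseteq> S" "card H = n + 1"
    and tails: "\<And>a b. b \<in> H \<Longrightarrow> (a, b) \<in> parcs D \<Longrightarrow> a \<in> S - H"
    using heads_of_cycle_edges[of cycle_expo "n + 1"] by (auto simp: lookup_cycle_expo)
  obtain par where par: "\<And>b. b \<in> S \<Longrightarrow> (par b, b) \<in> parcs D"
    using ex_in_neighbour S_verts by (metis subsetD)
  have fin: "finite H" using H(1) finite_S finite_subset by blast
  have "inj_on par H"
  proof (rule inj_onI)
    fix b b' assume b: "b \<in> H" "b' \<in> H" "par b = par b'"
    then have "(par b, b) \<in> set C" "(par b, b') \<in> set C" using par arc_into_S H(1) by fastforce+
    then show "b = b'" using C_props(4) by (metis distinct_map inj_on_def prod.inject fst_conv)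
  qed
  then have "card (par ` H) = n + 1" using card_image H(2) by metis
  moreover have "par ` H \<subseteq> S - H" using tails par H(1) by blast
  ultimately have "n + 1 \<le> card (S - H)" using card_mono[of "S - H"] finite_S by (metis finite_Diff)
  also have "\<dots> = n" using card_Diff_subset[OF fin H(1)] H(2) card_S by simp
  finally show False by simp
qed

lemma symbolic_power_neq_cycle:
  assumes "p \<in> S" "w p = 1"
  shows "symbolic_power (poly_ring (pverts D)) (edge_ideal D w :: ('v, 'k::field) mpoly set) (n + 1)
    \<noteq> edge_ideal D w [^]\<^bsub>ideals_set (poly_ring (pverts D))\<^esub> (n + 1)"
proof -
  obtain v where v: "(p, v) \<in> set C" using assms(1) by (force simp: S_def)
  obtain a where a: "(a, p) \<in> set C" using assms(1) snd_C by force
  show ?thesis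
  proof (rule symbolic_power_neq)
    show "(p, v) \<in> parcs D" using v C_arcs by blast
    show "w p = 1" by fact
    show "Poly_Mapping.keys cycle_expo \<subseteq> pverts D"
      using S_verts by (auto simp: in_keys_iff lookup_cycle_expo split: if_splits)
    show "cycle_expo \<notin> U (n + 1)" by (rule cycle_expo_notin)
    fix q assume "q = p \<or> q = v \<or> (v, q) \<in> parcs D"
    \<comment> \<open>The arcs come from the predecessor \<open>a\<close> of \<open>p\<close>, from
      \<open>p\<close> and from \<open>v\<close>; in the last case \<open>q\<close> may lie off the
      cycle.\<close>
    then have "\<exists>c \<in> S. (c, q) \<in> parcs D"
      using a v C_arcs C_in_S by blast
    then show "\<exists>k. Poly_Mapping.single q k + cycle_expo \<in> U (n + 1)"
      using cycle_expo_mult_mem by blast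
  qed
qed

section \<open>A vertex of weight one off the cycle\<close>

lemma arc_dist_le:
  assumes "(a, b) \<in> parcs D"
  shows "d a \<le> d b"
proof (cases "b \<in> S")
  case True
  then have "a \<in> S" using arc_into_S assms C_in_S by blast
  then show ?thesis by (simp add: dist_0)
next
  case False
  then show ?thesis using arc_outside assms by fastforce
qed

text \<open>Only the first inequality is weak: \<open>u\<close> and \<open>y\<close> may both lie on
  the cycle, while \<open>x\<close> and hence \<open>z\<close> do not.\<close>

lemma path_dist:
  assumes "(u, y) \<in> parcs D" "(y, x) \<in> parcs D" "(x, z) \<in> parcs D" "x \<notin> S"
  shows "d u \<le> d y" "d y < d x" "d x < d z"
proof -
  have "z \<notin> S" using arc_into_S assms C_in_S by blast
  then show "d u \<le> d y" "d y < d x" "d x < d z" using arc_dist_le arc_outside assms by auto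
qed

text \<open>Only the three arcs of the path have both ends in its support, and \<open>i\<close>,
  \<open>j\<close>, \<open>k\<close> count their uses in path order. The exponent of
  \<open>x\<close> takes \<open>j + k\<close> because \<open>x\<close> has weight one.\<close>

lemma path_edge_counts:
  assumes path: "(u, y) \<in> parcs D" "(y, x) \<in> parcs D" "(x, z) \<in> parcs D" and x: "x \<notin> S" "w x = 1"
    and m: "m \<in> U s" "Poly_Mapping.keys m \<subseteq> {u, y, x, z}"
  shows "\<exists>i j k. i + j + k = s \<and> i \<le> Poly_Mapping.lookup m u \<and>
    w y * i + j \<le> Poly_Mapping.lookup m y \<and> j + k \<le> Poly_Mapping.lookup m x \<and>
    w z * k \<le> Poly_Mapping.lookup m z"
proof -
  note dist = path_dist[OF path x(1)]
  have distinct: "u \<noteq> y" "u \<noteq> x" "u \<noteq> z" "y \<noteq> x" "y \<noteq> z" "x \<noteq> z"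
    using dist no_loops'[OF path(1)] by auto
  \<comment> \<open>\<open>x\<close> and \<open>z\<close> are too far out to point at
    \<open>u\<close>, and an arc from \<open>y\<close> would reverse an edge.\<close>
  have no_u: "(a, u) \<notin> parcs D" if "a \<in> {u, y, x, z}" for a
  proof
    assume a: "(a, u) \<in> parcs D"
    then have "d a \<le> d u" by (rule arc_dist_le)
    then show False using that a dist no_loops'[OF a] one_orientation[OF path(1)] by auto
  qed
  show ?thesis
    using m
  proof (induction s arbitrary: m)
    case 0
    then show ?case by simp
  next
    case (Suc s)
    obtain a b m' where ab: "(a, b) \<in> parcs D" and m': "m' \<in> U s"
      and m: "m = Poly_Mapping.single a 1 + Poly_Mapping.single b (w b) + m'"
      using Suc.prems(1) by (rule U_Suc_cases)
    have "w b \<ge> 1" using weight_pos in_arcsD2 ab by blast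
    then have sub: "a \<in> {u, y, x, z}" "b \<in> {u, y, x, z}" "Poly_Mapping.keys m' \<subseteq> {u, y, x, z}"
      using Suc.prems(2) by (auto simp: m keys_add_nat)
    obtain i j k where ijk: "i + j + k = s" "i \<le> Poly_Mapping.lookup m' u"
      "w y * i + j \<le> Poly_Mapping.lookup m' y" "j + k \<le> Poly_Mapping.lookup m' x"
      "w z * k \<le> Poly_Mapping.lookup m' z"
      using Suc.IH[OF m' sub(3)] by blast
    have "b \<noteq> u" using no_u[OF sub(1)] ab by blast
    \<comment> \<open>Uniqueness of in-neighbours determines the tail from each remaining
      head.\<close>
    then consider "b = y" "a = u" | "b = x" "a = y" | "b = z" "a = x"
      using sub(2) ab path in_neighbour_unique by blast
    then show ?case
    proof cases
      case 1
      then show ?thesis using ijk distinct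
        by (intro exI[of _ "i + 1"] exI[of _ j] exI[of _ k])
          (simp add: m lookup_add lookup_single when_def)
    next
      case 2
      then show ?thesis using ijk distinct x(2)
        by (intro exI[of _ i] exI[of _ "j + 1"] exI[of _ k])
          (simp add: m lookup_add lookup_single when_def)
    next
      case 3
      then show ?thesis using ijk distinct
        by (intro exI[of _ i] exI[of _ j] exI[of _ "k + 1"])
          (simp add: m lookup_add lookup_single when_def)
    qed
  qed
qed

lemma U_2I:
  assumes "(a, b) \<in> parcs D" "(a', b') \<in> parcs D"
    "\<And>t. Poly_Mapping.lookup (Poly_Mapping.single a 1 + Poly_Mapping.single b (w b) +
      (Poly_Mapping.single a' 1 + Poly_Mapping.single b' (w b'))) t \<le> Poly_Mapping.lookup f t"
  shows "f \<in> U 2"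
  using mem_power_expos_le[OF power_expos_add[OF edge_mem_U_1[OF assms(1)] edge_mem_U_1[OF assms(2)]]]
    assms(3) by (simp only: one_add_one)

lemma U_3I:
  assumes "(a, b) \<in> parcs D" "(a', b') \<in> parcs D" "(a'', b'') \<in> parcs D"
    "\<And>t. Poly_Mapping.lookup (Poly_Mapping.single a 1 + Poly_Mapping.single b (w b) +
      (Poly_Mapping.single a' 1 + Poly_Mapping.single b' (w b') +
      (Poly_Mapping.single a'' 1 + Poly_Mapping.single b'' (w b'')))) t \<le> Poly_Mapping.lookup f t"
  shows "f \<in> U 3"
proof -
  have "Poly_Mapping.single a 1 + Poly_Mapping.single b (w b) +
      (Poly_Mapping.single a' 1 + Poly_Mapping.single b' (w b') +
      (Poly_Mapping.single a'' 1 + Poly_Mapping.single b'' (w b''))) \<in> U (1 + (1 + 1))"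
    using assms(1-3) by (intro power_expos_add edge_mem_U_1)
  then have "f \<in> U (1 + (1 + 1))" using assms(4) by (rule mem_power_expos_le)
  then show ?thesis by (simp only: numeral_3_eq_3 One_nat_def add_Suc add_0)
qed

text \<open>The criterion is applied to the arc \<open>(x, z)\<close>, whose tail has weight one;
  counting uses of the path arcs shows that the monomial is not in the ordinary power.\<close>

lemma symbolic_power_neq_path:
  assumes path: "(u, y) \<in> parcs D" "(y, x) \<in> parcs D" "(x, z) \<in> parcs D"
    and x: "x \<notin> S" "w x = 1" and wy: "w y \<ge> 2"
  shows "\<exists>s\<ge>2. symbolic_power (poly_ring (pverts D)) (edge_ideal D w :: ('v, 'k::field) mpoly set) s
    \<noteq> edge_ideal D w [^]\<^bsub>ideals_set (poly_ring (pverts D))\<^esub> s"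
proof -
  have verts: "{u, y, x, z} \<subseteq> pverts D" using path in_arcsD1 in_arcsD2 by blast
  have wz: "w z \<ge> 1" using verts weight_pos by blast
  have distinct: "u \<noteq> y" "u \<noteq> x" "u \<noteq> z" "y \<noteq> x" "y \<noteq> z" "x \<noteq> z"
    using path_dist[OF path x(1)] no_loops'[OF path(1)] by auto
  note lookups = lookup_add lookup_single when_def
  show ?thesis
  proof (cases "w z = 1")
    case False
    define f where "f = Poly_Mapping.single u 1 + Poly_Mapping.single y (w y) +
      Poly_Mapping.single x 1 + Poly_Mapping.single z (1::nat)"
    have keys: "Poly_Mapping.keys f \<subseteq> {u, y, x, z}" by (auto simp: f_def keys_add_nat split: if_splits)
    have "f \<notin> U 2"
    proof
      assume "f \<in> U 2"
      then obtain i j k where "i + j + k = 2" "w y * i + j \<le> w y" "j + k \<le> 1" "w z * k \<le> 1"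
        using path_edge_counts[OF path x, of f 2] keys distinct by (auto simp: f_def lookups)
      \<comment> \<open>The exponent of \<open>z\<close> is below \<open>w z\<close>, so only
        \<open>(u, y)\<close> and \<open>(y, x)\<close> remain. Each fits at most once, and using
        the first leaves no \<open>y\<close> for the second.\<close>
      moreover have "k = 0" using calculation(4) wz False by (cases k) auto
      ultimately show False using wy by (cases i) auto
    qed
    moreover have "\<exists>k. Poly_Mapping.single q k + f \<in> U 2" if q: "q = x \<or> q = z \<or> (z, q) \<in> parcs D" for q
    proof -
      \<comment> \<open>The edges are \<open>(y, x)\<close> twice, by \<open>w y \<ge> 2\<close>;
        then \<open>(u, y)\<close> and \<open>(x, z)\<close>; then \<open>(y, x)\<close> and
        \<open>(z, q)\<close>.\<close>
      consider "q = x" | "q = z" | "(z, q) \<in> parcs D" using q by blast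
      then show ?thesis
      proof cases
        case 1
        have "Poly_Mapping.single x 1 + f \<in> U 2"
          using path(2) path(2) by (rule U_2I) (use wy x in \<open>auto simp: f_def lookups\<close>)
        then show ?thesis using 1 by blast
      next
        case 2
        have "Poly_Mapping.single z (w z) + f \<in> U 2"
          using path(1) path(3) by (rule U_2I) (use wy x in \<open>auto simp: f_def lookups\<close>)
        then show ?thesis using 2 by blast
      next
        case 3
        have "Poly_Mapping.single q (w q) + f \<in> U 2"
          using path(2) 3 by (rule U_2I) (use wy x in \<open>auto simp: f_def lookups\<close>)
        then show ?thesis by blast
      qed
    qed
    ultimately show ?thesis
      using symbolic_power_neq[OF path(3) x(2), of f 2] keys verts by (intro exI[of _ 2]) auto
  next
    case True
    define f where "f = Poly_Mapping.single u 1 + Poly_Mapping.single y (w y) +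
      Poly_Mapping.single x 2 + Poly_Mapping.single z (1::nat)"
    have keys: "Poly_Mapping.keys f \<subseteq> {u, y, x, z}" by (auto simp: f_def keys_add_nat split: if_splits)
    have "f \<notin> U 3"
    proof
      assume "f \<in> U 3"
      then obtain i j k where "i + j + k = 3" "i \<le> 1" "w y * i + j \<le> w y" "j + k \<le> 2" "k \<le> 1"
        using path_edge_counts[OF path x, of f 3] keys distinct True by (auto simp: f_def lookups)
      \<comment> \<open>At most two of the three edges differ from \<open>(u, y)\<close>. Using that
        edge exhausts \<open>y\<close>, which forces \<open>j = 0\<close> and \<open>k = 2\<close>,
        one more than \<open>z\<close> allows.\<close>
      moreover have "i = 1" using calculation by linarith
      ultimately show False by simp
    qed
    moreover have "\<exists>k. Poly_Mapping.single q k + f \<in> U 3" if q: "q = x \<or> q = z \<or> (z, q) \<in> parcs D" for q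
    proof -
      \<comment> \<open>The edges are \<open>(y, x)\<close> twice and \<open>(x, z)\<close>; then
        \<open>(u, y)\<close> and \<open>(x, z)\<close> twice; then \<open>(y, x)\<close> twice and
        \<open>(z, q)\<close>.\<close>
      consider "q = x" | "q = z" | "(z, q) \<in> parcs D" using q by blast
      then show ?thesis
      proof cases
        case 1
        have "Poly_Mapping.single x 1 + f \<in> U 3"
          using path(2) path(2) path(3) by (rule U_3I) (use wy x True in \<open>auto simp: f_def lookups\<close>)
        then show ?thesis using 1 by blast
      next
        case 2
        have "Poly_Mapping.single z 1 + f \<in> U 3"
          using path(1) path(3) path(3) by (rule U_3I) (use wy x True in \<open>auto simp: f_def lookups\<close>)
        then show ?thesis using 2 by blast
      next
        case 3
        have "Poly_Mapping.single q (w q) + f \<in> U 3"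
          using path(2) path(2) 3 by (rule U_3I) (use wy x in \<open>auto simp: f_def lookups\<close>)
        then show ?thesis by blast
      qed
    qed
    ultimately show ?thesis
      using symbolic_power_neq[OF path(3) x(2), of f 3] keys verts by (intro exI[of _ 3]) auto
  qed
qed

section \<open>The weight condition and equality of the powers\<close>

lemma ex_out_neighbour:
  assumes "graph_degree D x \<ge> 2"
  shows "\<exists>z. (x, z) \<in> parcs D"
proof (rule ccontr)
  assume "\<not> ?thesis"
  \<comment> \<open>Without out-neighbours all neighbours are in-neighbours, of which there is at
    most one.\<close>
  then have "\<exists>a. {y. (x, y) \<in> parcs (mk_symmetric (with_proj D))} \<subseteq> {a}"
    using in_neighbour_unique unfolding mem_parcs_mk_symmetric_iff
    by (metis (mono_tags, lifting) insertI1 mem_Collect_eq subsetI)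
  then obtain a where "{y. (x, y) \<in> parcs (mk_symmetric (with_proj D))} \<subseteq> {a}" by blast
  then have "card {y. (x, y) \<in> parcs (mk_symmetric (with_proj D))} \<le> card {a}"
    by (intro card_mono) auto
  then show False using assms by (simp add: graph_degree_def)
qed

lemma symbolic_powers_eq_iff:
  "(\<forall>s\<ge>2. symbolic_power (poly_ring (pverts D)) (edge_ideal D w :: ('v, 'k::field) mpoly set) s
      = edge_ideal D w [^]\<^bsub>ideals_set (poly_ring (pverts D))\<^esub> s)
    \<longleftrightarrow> (\<forall>x \<in> pverts D. graph_degree D x \<ge> 2 \<longrightarrow> w x \<ge> 2)" (is "?L \<longleftrightarrow> ?R")
proof
  assume ?R
  \<comment> \<open>An in-neighbour \<open>z\<close> of \<open>x\<close> has an in-neighbour of its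
    own, so its degree is at least 2.\<close>
  have "\<exists>z. (z, x) \<in> parcs D \<and> w z \<ge> 2" if x: "x \<in> pverts D" for x
  proof -
    obtain z where z: "(z, x) \<in> parcs D" using ex_in_neighbour[OF x] by blast
    then have zV: "z \<in> pverts D" by (rule in_arcsD1)
    then obtain a where "(a, z) \<in> parcs D" using ex_in_neighbour by blast
    then show ?thesis using \<open>?R\<close> z zV degree_ge_2 by blast
  qed
  then show ?L using symbolic_power_eq by blast
next
  assume L: ?L
  show ?R
  proof (rule ccontr)
    assume "\<not> ?R"
    \<comment> \<open>Among the violating vertices one nearest to the cycle is taken. If it is off
      the cycle, its in-neighbour is nearer and has degree at least 2, hence weight at least
      2.\<close>
    then have "\<exists>x. x \<in> pverts D \<and> graph_degree D x \<ge> 2 \<and> \<not> w x \<ge> 2" by blast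
    then obtain x where x: "x \<in> pverts D" "graph_degree D x \<ge> 2" "\<not> w x \<ge> 2"
      and least: "\<And>y. y \<in> pverts D \<Longrightarrow> graph_degree D y \<ge> 2 \<Longrightarrow> \<not> w y \<ge> 2 \<Longrightarrow> d x \<le> d y"
      using ex_has_least_nat[of "\<lambda>x. x \<in> pverts D \<and> graph_degree D x \<ge> 2 \<and> \<not> w x \<ge> 2" _ d] by blast
    have wx: "w x = 1" using x weight_pos[of x] by simp
    have "x \<notin> S"
    proof
      assume "x \<in> S"
      \<comment> \<open>The exponent of the cycle case is admissible because the cycle has at least
        three vertices.\<close>
      moreover have "n + 1 \<ge> 2" using n_pos by simp
      ultimately show False using L symbolic_power_neq_cycle[OF _ wx] by blast
    qed
    obtain y where y: "(y, x) \<in> parcs D" using ex_in_neighbour x(1) by blast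
    obtain z where z: "(x, z) \<in> parcs D" using ex_out_neighbour x(2) by blast
    have yV: "y \<in> pverts D" using y by (rule in_arcsD1)
    obtain u where u: "(u, y) \<in> parcs D" using ex_in_neighbour yV by blast
    have "d y < d x" using arc_outside y \<open>x \<notin> S\<close> by blast
    then have "w y \<ge> 2" using least[of y] degree_ge_2[OF u y] yV by force
    then show False using L symbolic_power_neq_path[OF u y z \<open>x \<notin> S\<close> wx] by blast
  qed
qed

end

theorem theorem3p11:
  fixes D :: "'v pair_pre_digraph" and w :: "'v \<Rightarrow> nat"
    and C :: "('v \<times> 'v) list" and n :: nat
  assumes "weighted_oriented_graph D w"
    and "naturally_oriented_unicyclic D"
    and "pre_digraph.cycle D C" and "length C = 2 * n + 1"
  shows "(\<forall>s\<ge>2. symbolic_power (poly_ring (pverts D)) (edge_ideal D w :: ('v, 'k::field) mpoly set) s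
                = edge_ideal D w [^]\<^bsub>ideals_set (poly_ring (pverts D))\<^esub> s)
         \<longleftrightarrow> (\<forall>x \<in> pverts D. graph_degree D x \<ge> 2 \<longrightarrow> w x \<ge> 2)"
proof -
  interpret weighted_oriented_graph D w by fact
  interpret odd_unicyclic D w C n using assms(2-4) by unfold_locales
  show ?thesis by (rule symbolic_powers_eq_iff)
qed

end
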